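(* Let $\mathcal{H}$ be a complex Hilbert space, let $A\in\mathcal{B}(\mathcal{H})$ be invertible, and let $r\geq 1$ be a real number. Define \[ \Phi_{A,r}(\theta)=\frac14\left\| |A|^{4r\theta}+|A^*|^{4r(1-\theta)}\right\| +\frac12\, w\!\left(|A|^{2r\theta}|A^*|^{2r(1-\theta)}\right),\qquad 0\leq\theta\leq 1. \] Then \[ w^{2r}(A)\leq \min_{0\leq\theta\leq 1}\Phi_{A,r}(\theta)\leq \Phi_{A,r}\!\left(\tfrac12\right), \] where \[ \Phi_{A,r}\!\left(\tfrac12\right)=\frac14\left\| |A|^{2r}+|A^*|^{2r}\right\|+\frac12\, w\!\left(|A|^r|A^*|^r\right). \] Moreover, if $\Phi_{A,r}(\theta_0)<\Phi_{A,r}(\tfrac12)$ for some $\theta_0\in[0,1]$, then the optimized estimate is strictly sharper than the one corresponding to $\theta=\tfrac12$, that is, $\min_{0\leq\theta\leq 1}\Phi_{A,r}(\theta)<\Phi_{A,r}(\tfrac12)$.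
   Context: $\mathcal{B}(\mathcal{H})$ is the algebra of bounded linear operators on the complex Hilbert space $\mathcal{H}$, and $\|\cdot\|$ is the operator norm. For $T\in\mathcal{B}(\mathcal{H})$, the numerical radius is $w(T)=\sup\{|\langle Tx,x\rangle| : x\in\mathcal{H},\ \|x\|=1\}$, and $w^{2r}(T)$ means $(w(T))^{2r}$. $|T|=(T^*T)^{1/2}$, so $|T^*|=(TT^* )^{1/2}$. Real nonnegative powers of positive operators are taken via the continuous functional calculus. Writing $\min$ includes the assertion that the minimum is attained. *)

theory Defs
  imports "HOL-Analysis.Analysis" "HOL-Computational_Algebra.Polynomial"
begin

text \<open>The inner product is linear in the first argument. Positive definiteness is contained
  in \<open>cinner_self\<close>, and completeness in the superclass \<^class>\<open>banach\<close>.\<close>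

class complex_hilbert_space = banach +
  fixes scaleC :: "complex \<Rightarrow> 'a \<Rightarrow> 'a" (infixr "*\<^sub>C" 75)
    and cinner :: "'a \<Rightarrow> 'a \<Rightarrow> complex"
  assumes scaleC_add_right: "c *\<^sub>C (x + y) = c *\<^sub>C x + c *\<^sub>C y"
    and scaleC_add_left: "(c + d) *\<^sub>C x = c *\<^sub>C x + d *\<^sub>C x"
    and scaleC_scaleC: "c *\<^sub>C d *\<^sub>C x = (c * d) *\<^sub>C x"
    and scaleC_of_real: "complex_of_real t *\<^sub>C x = t *\<^sub>R x"
    and cinner_add_left: "cinner (x + y) z = cinner x z + cinner y z"
    and cinner_scaleC_left: "cinner (c *\<^sub>C x) y = c * cinner x y"
    and cinner_commute: "cinner x y = cnj (cinner y x)"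
    and cinner_self: "cinner x x = complex_of_real ((norm x)\<^sup>2)"

text \<open>The algebra of bounded complex-linear operators, as a subset of the bounded real-linear
  operators \<^typ>\<open>'a \<Rightarrow>\<^sub>L 'a\<close>, whose library norm is the operator norm.\<close>

definition bounded_ops :: "('a::complex_hilbert_space \<Rightarrow>\<^sub>L 'a) set" where
  "bounded_ops = {T. \<forall>c x. blinfun_apply T (c *\<^sub>C x) = c *\<^sub>C blinfun_apply T x}"

definition invertible_op :: "('a::complex_hilbert_space \<Rightarrow>\<^sub>L 'a) \<Rightarrow> bool" where
  "invertible_op T \<longleftrightarrow>
     (\<exists>S\<in>bounded_ops. S o\<^sub>L T = id_blinfun \<and> T o\<^sub>L S = id_blinfun)"

definition cadjoint :: "('a::complex_hilbert_space \<Rightarrow>\<^sub>L 'a) \<Rightarrow> 'a \<Rightarrow>\<^sub>L 'a" where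
  "cadjoint T = (THE S. S \<in> bounded_ops \<and>
     (\<forall>x y. cinner (blinfun_apply T x) y = cinner x (blinfun_apply S y)))"

text \<open>Inserting \<open>0\<close> only matters for the zero space, where there are no unit vectors
  and the supremum of the empty set of nonnegative reals is taken to be \<open>0\<close>.\<close>

definition numerical_radius :: "('a::complex_hilbert_space \<Rightarrow>\<^sub>L 'a) \<Rightarrow> real" where
  "numerical_radius T =
     Sup (insert 0 {cmod (cinner (blinfun_apply T x) x) | x. norm x = 1})"

definition op_spectrum :: "('a::complex_hilbert_space \<Rightarrow>\<^sub>L 'a) \<Rightarrow> complex set" where
  "op_spectrum T = {c. \<not> (\<exists>S\<in>bounded_ops. \<forall>x.
     blinfun_apply S (blinfun_apply T x - c *\<^sub>C x) = x \<and>
     blinfun_apply T (blinfun_apply S x) - c *\<^sub>C blinfun_apply S x = x)}"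

definition op_poly :: "real poly \<Rightarrow> ('a::complex_hilbert_space \<Rightarrow>\<^sub>L 'a) \<Rightarrow> 'a \<Rightarrow>\<^sub>L 'a" where
  "op_poly p T = (\<Sum>i\<le>degree p. coeff p i *\<^sub>R (((o\<^sub>L) T) ^^ i) id_blinfun)"

text \<open>Continuous functional calculus of a self-adjoint operator \<open>T\<close>, whose spectrum is real,
  for real functions \<open>f\<close> continuous on the spectrum: \<open>f(T)\<close> is the limit in operator
  norm of \<open>p\<^sub>n(T)\<close> for any polynomials \<open>p\<^sub>n\<close> converging to \<open>f\<close> uniformly on the spectrum.\<close>

definition cont_fun_calc ::
    "(real \<Rightarrow> real) \<Rightarrow> ('a::complex_hilbert_space \<Rightarrow>\<^sub>L 'a) \<Rightarrow> 'a \<Rightarrow>\<^sub>L 'a" where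
  "cont_fun_calc f T = (THE S. \<forall>p :: nat \<Rightarrow> real poly.
     uniform_limit {t. complex_of_real t \<in> op_spectrum T} (\<lambda>n. poly (p n)) f sequentially
     \<longrightarrow> (\<lambda>n. op_poly (p n) T) \<longlonglongrightarrow> S)"

text \<open>Powers \<open>T\<^sup>s\<close> of a positive operator, \<open>s \<ge> 0\<close>. The case distinction
  gives \<open>T\<^sup>0 = I\<close> also if \<open>0\<close> is in the spectrum, since \<^prop>\<open>(0::real) powr 0 = 0\<close>.\<close>

definition op_powr :: "('a::complex_hilbert_space \<Rightarrow>\<^sub>L 'a) \<Rightarrow> real \<Rightarrow> 'a \<Rightarrow>\<^sub>L 'a" where
  "op_powr T s = cont_fun_calc (\<lambda>t. if s = 0 then 1 else t powr s) T"

definition op_abs :: "('a::complex_hilbert_space \<Rightarrow>\<^sub>L 'a) \<Rightarrow> 'a \<Rightarrow>\<^sub>L 'a" where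
  "op_abs T = op_powr (cadjoint T o\<^sub>L T) (1/2)"

definition Phi :: "('a::complex_hilbert_space \<Rightarrow>\<^sub>L 'a) \<Rightarrow> real \<Rightarrow> real \<Rightarrow> real" where
  "Phi A r \<theta> =
     1/4 * norm (op_powr (op_abs A) (4 * r * \<theta>)
                 + op_powr (op_abs (cadjoint A)) (4 * r * (1 - \<theta>)))
     + 1/2 * numerical_radius (op_powr (op_abs A) (2 * r * \<theta>)
                 o\<^sub>L op_powr (op_abs (cadjoint A)) (2 * r * (1 - \<theta>)))"

end

theory Submission
  imports Defs "HOL-Computational_Algebra.Fundamental_Theorem_Algebra"
begin

text \<open>
  Fix \<open>\<theta>\<close> and a unit vector \<open>x\<close>. The polar decomposition \<open>A = V\<bar>A\<bar>\<close> with
  \<open>V\<bar>A\<bar> = \<bar>A\<^sup>*\<bar>V\<close> gives \<open>\<langle>Ax, x\<rangle> = \<langle>V\<bar>A\<bar>\<^sup>\<theta>x, \<bar>A\<^sup>*\<bar>\<^bsup>1-\<theta>\<^esup>x\<rangle>\<close>, hence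
  \<open>\<bar>\<langle>Ax, x\<rangle>\<bar>\<^sup>2 \<le> \<langle>\<bar>A\<bar>\<^bsup>2\<theta>\<^esup>x, x\<rangle> \<langle>\<bar>A\<^sup>*\<bar>\<^bsup>2(1-\<theta>)\<^esup>x, x\<rangle>\<close>
  (\<open>mixed_Schwarz_inequality\<close>). Raising this to the power \<open>r \<ge> 1\<close>, the exponent moves inside
  the inner products (\<open>McCarthy_inequality\<close>), which leaves \<open>\<langle>Px, x\<rangle>\<langle>x, Qx\<rangle>\<close> with
  \<open>P = \<bar>A\<bar>\<^bsup>2r\<theta>\<^esup>\<close> and \<open>Q = \<bar>A\<^sup>*\<bar>\<^bsup>2r(1-\<theta>)\<^esup>\<close>. By \<open>Buzano_inequality\<close> this is at most
  \<open>(\<parallel>Px\<parallel>\<parallel>Qx\<parallel> + \<bar>\<langle>Px, Qx\<rangle>\<bar>)/2\<close>, and the two summands produce the two terms of \<open>\<Phi>\<close>. The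
  supremum over \<open>x\<close> bounds the numerical radius for every \<open>\<theta>\<close>. Invertibility of \<open>A\<close> makes
  \<open>\<bar>A\<bar>\<close> and \<open>\<bar>A\<^sup>*\<bar>\<close> bounded below by positive constants, so their powers depend continuously
  in norm on the exponent and \<open>\<Phi>\<close> attains its minimum on \<open>[0, 1]\<close>
  (\<open>continuous_on_Phi\<close>).

  All of this rests on adjoints and on the continuous functional calculus. Adjoints come from the
  Riesz representation theorem. The calculus comes from the estimate
  \<open>\<parallel>p(T)\<parallel> \<le> sup \<bar>p\<bar>\<close> over the spectrum, for self-adjoint \<open>T\<close> and real polynomials \<open>p\<close>
  (\<open>norm_op_poly_le\<close>). It has two ingredients. First, \<open>\<parallel>S\<parallel>\<close> or \<open>-\<parallel>S\<parallel>\<close> is a spectral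
  value of a nonzero self-adjoint \<open>S\<close> (\<open>norm_le_of_real_resolvent\<close>). Second, if \<open>q\<close> has no zero in
  the real spectrum of \<open>T\<close>, then \<open>q(T)\<close> is invertible (\<open>op_poly_invertible\<close>): each real
  irreducible factor of \<open>q\<close> gives an invertible operator, the quadratic ones because they are
  coercive. For \<open>q = p - c\<close> this locates the spectrum of \<open>p(T)\<close>. Together with the Weierstrass
  approximation theorem, the estimate turns identities for polynomials into identities for
  continuous functions.
\<close>

section \<open>Inner product\<close>

lemma cinner_add_right:
  "cinner x (y + z) = cinner x y + cinner (x::'a::complex_hilbert_space) z"
  by (metis cinner_commute cinner_add_left complex_cnj_add)

lemma cinner_scaleC_right:
  "cinner x (c *\<^sub>C y) = cnj c * cinner (x::'a::complex_hilbert_space) y"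
  by (metis cinner_commute cinner_scaleC_left complex_cnj_mult)

lemma cinner_scaleR_left:
  "cinner (t *\<^sub>R x) y = of_real t * cinner (x::'a::complex_hilbert_space) y"
  by (simp add: scaleC_of_real [symmetric] cinner_scaleC_left)

lemma cinner_scaleR_right:
  "cinner x (t *\<^sub>R y) = of_real t * cinner (x::'a::complex_hilbert_space) y"
  by (simp add: scaleC_of_real [symmetric] cinner_scaleC_right)

lemma cinner_minus_left: "cinner (- x) y = - cinner (x::'a::complex_hilbert_space) y"
  using cinner_scaleR_left [of "-1" x y] by simp

lemma cinner_minus_right: "cinner x (- y) = - cinner (x::'a::complex_hilbert_space) y"
  using cinner_scaleR_right [of x "-1" y] by simp

lemma cinner_diff_left:
  "cinner (x - y) z = cinner x z - cinner (y::'a::complex_hilbert_space) z"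
  using cinner_add_left [of x "- y" z] by (simp add: cinner_minus_left)

lemma cinner_diff_right:
  "cinner x (y - z) = cinner x y - cinner (x::'a::complex_hilbert_space) z"
  using cinner_add_right [of x y "- z"] by (simp add: cinner_minus_right)

lemmas cinner_simps = cinner_add_left cinner_add_right cinner_diff_left cinner_diff_right
  cinner_scaleR_left cinner_scaleR_right cinner_scaleC_left cinner_scaleC_right

lemma norm_eq_Re_cinner: "(norm x)\<^sup>2 = Re (cinner x (x::'a::complex_hilbert_space))"
  by (simp add: cinner_self)

lemma Re_cinner_commute: "Re (cinner y x) = Re (cinner x (y::'a::complex_hilbert_space))"
  by (metis cinner_commute complex_cnj(1) complex.exhaust_sel complex.sel(1))

lemma norm_add_squared:
  "(norm (x + y))\<^sup>2
     = (norm x)\<^sup>2 + 2 * Re (cinner x y) + (norm (y::'a::complex_hilbert_space))\<^sup>2"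
  by (simp add: norm_eq_Re_cinner cinner_simps Re_cinner_commute [of y x])

lemma norm_diff_squared:
  "(norm (x - y))\<^sup>2
     = (norm x)\<^sup>2 - 2 * Re (cinner x y) + (norm (y::'a::complex_hilbert_space))\<^sup>2"
  by (simp add: norm_eq_Re_cinner cinner_simps Re_cinner_commute [of y x])

lemma norm_scaleC: "norm (c *\<^sub>C x) = cmod c * norm (x::'a::complex_hilbert_space)"
proof -
  have "complex_of_real ((norm (c *\<^sub>C x))\<^sup>2) = c * cnj c * complex_of_real ((norm x)\<^sup>2)"
    unfolding cinner_self [symmetric] by (simp add: cinner_simps)
  also have "\<dots> = complex_of_real ((cmod c * norm x)\<^sup>2)"
    by (simp only: power_mult_distrib of_real_mult complex_norm_square)
  finally have "(norm (c *\<^sub>C x))\<^sup>2 = (cmod c * norm x)\<^sup>2"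
    unfolding of_real_eq_iff .
  then show ?thesis
    by (simp add: power2_eq_iff_nonneg)
qed

text \<open>The real part is bounded by comparing \<open>\<parallel>x + y\<parallel>\<^sup>2\<close> with the triangle inequality; rotating
  \<open>x\<close> by a phase turns the real part into the modulus.\<close>

lemma cinner_Cauchy_Schwarz:
  "cmod (cinner x y) \<le> norm x * norm (y::'a::complex_hilbert_space)"
proof -
  have re: "Re (cinner u v) \<le> norm u * norm v" for u v :: 'a
    using power_mono [OF norm_triangle_ineq [of u v], of 2]
    by (simp add: norm_add_squared power2_sum)
  show ?thesis
  proof (cases "cinner x y = 0")
    case False
    define c where "c = cnj (cinner x y) / cmod (cinner x y)"
    have "cmod c = 1"
      using False by (simp add: c_def norm_divide)
    have "c * cinner x y = cmod (cinner x y)"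
      using False complex_norm_square [of "cinner x y"]
      by (simp add: c_def divide_eq_eq power2_eq_square mult.commute)
    then have "cmod (cinner x y) = Re (cinner (c *\<^sub>C x) y)"
      by (simp add: cinner_simps)
    also have "\<dots> \<le> norm x * norm y"
      using re [of "c *\<^sub>C x" y] \<open>cmod c = 1\<close> by (simp add: norm_scaleC)
    finally show ?thesis .
  qed simp
qed

lemma bounded_bilinear_cinner:
  "bounded_bilinear (cinner :: 'a::complex_hilbert_space \<Rightarrow> 'a \<Rightarrow> complex)"
proof
  show "\<exists>K. \<forall>a b::'a. norm (cinner a b) \<le> norm a * norm b * K"
    using cinner_Cauchy_Schwarz by (intro exI [of _ 1]) auto
qed (auto simp: cinner_simps scaleR_conv_of_real)

text \<open>The reflection \<open>a \<mapsto> 2\<langle>a, x\<rangle>x - a\<close> in the line of a unit vector \<open>x\<close> preserves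
  norms, so Buzano's inequality is Cauchy-Schwarz for the reflected vector.\<close>

lemma Buzano_inequality:
  assumes "norm (x::'a::complex_hilbert_space) = 1"
  shows "cmod (cinner a x * cinner x b) \<le> (norm a * norm b + cmod (cinner a b)) / 2"
proof -
  define u where "u = (2 * cinner a x) *\<^sub>C x - a"
  have "(norm u)\<^sup>2 = (norm ((2 * cinner a x) *\<^sub>C x))\<^sup>2
          - 2 * Re (2 * (cinner a x * cinner x a)) + (norm a)\<^sup>2"
    unfolding u_def norm_diff_squared by (simp add: cinner_simps mult.assoc)
  also have "\<dots> = (norm a)\<^sup>2"
    using assms cinner_commute [of x a]
    by (simp add: norm_scaleC norm_mult power_mult_distrib cmod_power2)
      (simp add: power2_eq_square algebra_simps)
  finally have "norm u = norm a"
    by (simp add: power2_eq_iff_nonneg)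
  then have "cmod (cinner u b) \<le> norm a * norm b"
    using cinner_Cauchy_Schwarz [of u b] by simp
  moreover have "2 * (cinner a x * cinner x b) = cinner u b + cinner a b"
    by (simp add: u_def cinner_simps)
  ultimately have "cmod (2 * (cinner a x * cinner x b)) \<le> norm a * norm b + cmod (cinner a b)"
    by (metis norm_triangle_le add_mono order_refl)
  then show ?thesis
    by (simp add: norm_mult)
qed

section \<open>Riesz representation and adjoints\<close>

text \<open>The representing vector is the minimiser of \<open>J x = \<parallel>x\<parallel>\<^sup>2 - 2 Re (f x)\<close>. By the
  parallelogram law \<open>\<parallel>x - y\<parallel>\<^sup>2 / 2 = J x + J y - 2 J ((x + y)/2)\<close>, so minimising sequences are
  Cauchy, and the first variation of \<open>J\<close> vanishes at the limit.\<close>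

lemma Riesz_representation:
  fixes f :: "'a::complex_hilbert_space \<Rightarrow> complex"
  assumes f: "bounded_linear f" and fC: "\<And>c x. f (c *\<^sub>C x) = c * f x"
  shows "\<exists>z. \<forall>x. f x = cinner x z"
proof -
  interpret bounded_linear f by (rule f)
  obtain K where K: "\<And>x. norm (f x) \<le> norm x * K"
    using bounded by blast
  define J where "J x = (norm x)\<^sup>2 - 2 * Re (f x)" for x
  have J_lower: "- K\<^sup>2 \<le> J x" for x
  proof -
    have "Re (f x) \<le> norm x * K"
      using K [of x] complex_Re_le_cmod order_trans by blast
    moreover have "0 \<le> (norm x - K)\<^sup>2" by simp
    ultimately show ?thesis
      unfolding J_def power2_diff by linarith
  qed
  then have bdd: "bdd_below (range J)" by (auto simp: bdd_below_def)
  define d where "d = Inf (range J)"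
  have d_le: "d \<le> J x" for x
    unfolding d_def using bdd by (auto intro: cInf_lower)
  have "\<exists>x. J x < d + inverse (real (Suc n))" for n
    using cInf_lessD [of "range J" "d + inverse (real (Suc n))"] by (auto simp: d_def)
  then obtain X where X: "\<And>n. J (X n) < d + inverse (real (Suc n))"
    by metis
  have para: "(norm (x - y))\<^sup>2 \<le> 2 * J x + 2 * J y - 4 * d" for x y
  proof -
    have "J x + J y - 2 * J ((1/2) *\<^sub>R (x + y)) = (norm (x - y))\<^sup>2 / 2"
      unfolding J_def
      by (simp add: power_divide norm_add_squared norm_diff_squared scaleR add cinner_simps field_simps)
    then show ?thesis
      using d_le [of "(1/2) *\<^sub>R (x + y)"] by linarith
  qed
  have "Cauchy X"
  proof (rule metric_CauchyI)
    fix e :: real assume "0 < e"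
    then obtain N where N: "inverse (real (Suc N)) < e\<^sup>2 / 4"
      using reals_Archimedean [of "e\<^sup>2 / 4"] by auto
    have small: "J (X n) < d + e\<^sup>2 / 4" if "N \<le> n" for n
    proof -
      have "inverse (real (Suc n)) \<le> inverse (real (Suc N))"
        using that by (simp add: field_simps)
      then show ?thesis using N X [of n] by linarith
    qed
    have "dist (X m) (X n) < e" if "N \<le> m" "N \<le> n" for m n
    proof -
      have "(norm (X m - X n))\<^sup>2 < e\<^sup>2"
        using para [of "X m" "X n"] small [OF that(1)] small [OF that(2)] by linarith
      then show ?thesis
        using \<open>0 < e\<close> by (simp add: dist_norm power_less_imp_less_base)
    qed
    then show "\<exists>M. \<forall>m\<ge>M. \<forall>n\<ge>M. dist (X m) (X n) < e" by blast
  qed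
  then obtain z where z: "X \<longlonglongrightarrow> z"
    using Cauchy_convergent convergent_def by blast
  have "(\<lambda>n. J (X n)) \<longlonglongrightarrow> J z"
    unfolding J_def by (intro tendsto_intros tendsto z)
  moreover have "(\<lambda>n. d + inverse (real (Suc n))) \<longlonglongrightarrow> d + 0"
    by (intro tendsto_intros LIMSEQ_inverse_real_of_nat)
  ultimately have "J z \<le> d"
    using X by (auto intro: LIMSEQ_le less_imp_le)
  have re: "Re (f h) = Re (cinner h z)" for h
  proof -
    define \<alpha> where "\<alpha> = Re (cinner h z) - Re (f h)"
    define \<beta> where "\<beta> = (norm h)\<^sup>2"
    \<comment> \<open>The minimiser over \<open>t\<close> is \<open>- \<alpha> / \<beta>\<close>; the summand \<open>1\<close> covers \<open>h = 0\<close>.\<close>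
    define t where "t = - \<alpha> / (\<beta> + 1)"
    have "0 \<le> \<beta>" by (simp add: \<beta>_def)
    have "J (z + t *\<^sub>R h) = J z + 2 * t * \<alpha> + t\<^sup>2 * \<beta>"
      by (simp add: J_def \<alpha>_def \<beta>_def norm_add_squared add scaleR cinner_simps
          Re_cinner_commute [of z h] power_mult_distrib algebra_simps)
    then have "0 \<le> 2 * t * \<alpha> + t\<^sup>2 * \<beta>"
      using d_le [of "z + t *\<^sub>R h"] \<open>J z \<le> d\<close> by linarith
    also have "\<dots> = - (\<alpha>\<^sup>2 * (\<beta> + 2)) / (\<beta> + 1)\<^sup>2"
      using \<open>0 \<le> \<beta>\<close> by (simp add: t_def divide_simps power2_eq_square) algebra
    finally have "\<alpha>\<^sup>2 * (\<beta> + 2) \<le> 0"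
      using \<open>0 \<le> \<beta>\<close> by (simp add: field_simps zero_le_divide_iff)
    then have "\<alpha> = 0"
      using \<open>0 \<le> \<beta>\<close> by (simp add: mult_le_0_iff)
    then show ?thesis by (simp add: \<alpha>_def)
  qed
  have "f h = cinner h z" for h
  proof (rule complex_eqI [OF re])
    show "Im (f h) = Im (cinner h z)"
      using re [of "\<i> *\<^sub>C h"] by (simp add: fC cinner_simps)
  qed
  then show ?thesis by blast
qed

lemma cinner_eqI: 
  assumes "\<And>x. cinner x y = cinner x (z::'a::complex_hilbert_space)"
  shows "y = z"
proof -
  have "(norm (y - z))\<^sup>2 = 0"
    unfolding norm_eq_Re_cinner cinner_diff_right [of _ y z] by (simp add: assms)
  then show ?thesis by simp
qed

lemma cadjoint_unique:
  assumes "S \<in> bounded_ops" "\<And>x y. cinner (blinfun_apply T x) y = cinner x (blinfun_apply S y)"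
  shows "cadjoint T = S"
  unfolding cadjoint_def
proof (rule the_equality)
  show "S \<in> bounded_ops \<and> (\<forall>x y. cinner (blinfun_apply T x) y = cinner x (blinfun_apply S y))"
    using assms by blast
  fix S' :: "'a \<Rightarrow>\<^sub>L 'a"
  assume "S' \<in> bounded_ops \<and> (\<forall>x y. cinner (blinfun_apply T x) y = cinner x (blinfun_apply S' y))"
  then show "S' = S"
    using assms(2) by (intro blinfun_eqI cinner_eqI) metis
qed

text \<open>For fixed \<open>y\<close>, the value \<open>S y\<close> represents the functional \<open>x \<mapsto> \<langle>T x, y\<rangle>\<close>.\<close>

lemma adjoint_exists:
  fixes T :: "'a::complex_hilbert_space \<Rightarrow>\<^sub>L 'a"
  assumes T: "T \<in> bounded_ops"
  shows "\<exists>S\<in>bounded_ops. \<forall>x y. cinner (blinfun_apply T x) y = cinner x (blinfun_apply S y)"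
proof -
  have "\<exists>z. \<forall>x. cinner (blinfun_apply T x) y = cinner x z" for y
  proof (rule Riesz_representation)
    show "bounded_linear (\<lambda>x. cinner (blinfun_apply T x) y)"
      by (intro bounded_bilinear.bounded_linear_left [OF bounded_bilinear_cinner, THEN bounded_linear_compose]
          blinfun.bounded_linear_right)
  qed (use T in \<open>simp add: bounded_ops_def cinner_scaleC_left\<close>)
  then obtain g where g: "\<And>x y. cinner (blinfun_apply T x) y = cinner x (g y)"
    by metis
  have bound: "norm (g y) \<le> norm y * norm T" for y
  proof (cases "g y = 0")
    case False
    have "(norm (g y))\<^sup>2 = Re (cinner (blinfun_apply T (g y)) y)"
      by (simp add: g norm_eq_Re_cinner)
    also have "\<dots> \<le> norm (blinfun_apply T (g y)) * norm y"
      using cinner_Cauchy_Schwarz complex_Re_le_cmod order_trans by blast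
    also have "\<dots> \<le> norm T * norm (g y) * norm y"
      by (intro mult_right_mono norm_blinfun) simp
    finally have "norm (g y) * norm (g y) \<le> norm (g y) * (norm y * norm T)"
      by (simp add: power2_eq_square mult_ac)
    then show ?thesis using False by simp
  qed simp
  have gadd: "g (x + y) = g x + g y" for x y
    by (rule cinner_eqI) (simp add: cinner_simps flip: g)
  have gC: "g (c *\<^sub>C x) = c *\<^sub>C g x" for c x
    by (rule cinner_eqI) (simp add: cinner_simps flip: g)
  have lin: "bounded_linear g"
  proof
    show "g (r *\<^sub>R x) = r *\<^sub>R g x" for r x
      using gC [of "of_real r" x] by (simp add: scaleC_of_real)
    show "\<exists>K. \<forall>x. norm (g x) \<le> norm x * K"
      using bound by blast
  qed (rule gadd)
  show ?thesis
    using gC g by (intro bexI [of _ "Blinfun g"])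
      (auto simp: bounded_ops_def bounded_linear_Blinfun_apply [OF lin])
qed

lemma cadjoint:
  assumes "T \<in> bounded_ops"
  shows cadjoint_in_bounded_ops: "cadjoint T \<in> bounded_ops"
    and cinner_cadjoint_right:
      "cinner x (blinfun_apply (cadjoint T) y) = cinner (blinfun_apply T x) y"
  using adjoint_exists [OF assms] cadjoint_unique by metis+

lemma cinner_cadjoint_left:
  assumes "T \<in> bounded_ops"
  shows "cinner (blinfun_apply (cadjoint T) x) y = cinner x (blinfun_apply T y)"
  by (metis assms cinner_cadjoint_right cinner_commute)

lemma cadjoint_cadjoint: "T \<in> bounded_ops \<Longrightarrow> cadjoint (cadjoint T) = T"
  by (simp add: cadjoint_unique cinner_cadjoint_left)

section \<open>Invertibility\<close>

lemma blinfun_eq_iff: "S = T \<longleftrightarrow> (\<forall>x. blinfun_apply S x = blinfun_apply T x)"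
  by (metis blinfun_eqI)

lemma bounded_ops_id [simp]: "id_blinfun \<in> bounded_ops"
  by (simp add: bounded_ops_def)

lemma bounded_ops_compose [intro]:
  "S \<in> bounded_ops \<Longrightarrow> T \<in> bounded_ops \<Longrightarrow> S o\<^sub>L T \<in> bounded_ops"
  by (simp add: bounded_ops_def)

lemma scaleC_scaleR: "c *\<^sub>C (t *\<^sub>R x) = t *\<^sub>R (c *\<^sub>C (x::'a::complex_hilbert_space))"
  by (simp add: scaleC_of_real [symmetric] scaleC_scaleC mult.commute)

lemma scaleC_diff_right: "c *\<^sub>C (x - y) = c *\<^sub>C x - c *\<^sub>C (y::'a::complex_hilbert_space)"
  by (metis scaleC_add_right add_diff_cancel diff_add_cancel)

lemma bounded_ops_add [intro]:
  "S \<in> bounded_ops \<Longrightarrow> T \<in> bounded_ops \<Longrightarrow> S + T \<in> bounded_ops"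
  by (simp add: bounded_ops_def blinfun.add_left scaleC_add_right)

lemma bounded_ops_diff [intro]:
  "S \<in> bounded_ops \<Longrightarrow> T \<in> bounded_ops \<Longrightarrow> S - T \<in> bounded_ops"
  by (simp add: bounded_ops_def blinfun.diff_left scaleC_diff_right)

lemma bounded_ops_scaleR [intro]: "T \<in> bounded_ops \<Longrightarrow> t *\<^sub>R T \<in> bounded_ops"
  by (simp add: bounded_ops_def blinfun.scaleR_left scaleC_scaleR)

lemma invertible_bounded_below:
  fixes T :: "'a::complex_hilbert_space \<Rightarrow>\<^sub>L 'a"
  assumes "invertible_op T"
  shows "\<exists>c>0. \<forall>x. c * norm x \<le> norm (blinfun_apply T x)"
proof -
  obtain S where S: "S o\<^sub>L T = id_blinfun"
    using assms by (auto simp: invertible_op_def)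
  have "norm x \<le> (norm S + 1) * norm (blinfun_apply T x)" for x
  proof -
    have "x = blinfun_apply S (blinfun_apply T x)"
      by (metis S blinfun_apply_blinfun_compose blinfun_apply_id_blinfun id_apply)
    then have "norm x \<le> norm S * norm (blinfun_apply T x)"
      by (metis norm_blinfun)
    also have "\<dots> \<le> (norm S + 1) * norm (blinfun_apply T x)"
      by (intro mult_right_mono) auto
    finally show ?thesis .
  qed
  moreover have "norm S + 1 > 0"
    using norm_ge_zero [of S] by linarith
  ultimately show ?thesis
    by (intro exI [of _ "1 / (norm S + 1)"]) (auto simp: field_simps)
qed

lemma invertible_opI:
  fixes T :: "'a::complex_hilbert_space \<Rightarrow>\<^sub>L 'a"
  assumes T: "T \<in> bounded_ops" and "c > 0"
    and below: "\<And>x. c * norm x \<le> norm (blinfun_apply T x)"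
    and surj: "\<And>y. \<exists>x. blinfun_apply T x = y"
  shows "invertible_op T"
proof -
  obtain g where g: "\<And>y. blinfun_apply T (g y) = y"
    using surj by metis
  have inj: "x = y" if "blinfun_apply T x = blinfun_apply T y" for x y
    using below [of "x - y"] that \<open>c > 0\<close> by (simp add: blinfun.diff_right mult_le_0_iff)
  have lin: "bounded_linear g"
  proof
    show "g (x + y) = g x + g y" for x y
      by (rule inj) (simp add: g blinfun.add_right)
    show "g (t *\<^sub>R x) = t *\<^sub>R g x" for t x
      by (rule inj) (simp add: g blinfun.scaleR_right)
    have "norm (g x) \<le> norm x * (1 / c)" for x
      using below [of "g x"] \<open>c > 0\<close> by (simp add: g field_simps)
    then show "\<exists>K. \<forall>x. norm (g x) \<le> norm x * K" by blast
  qed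
  have "g (z *\<^sub>C x) = z *\<^sub>C g x" for z x
    by (rule inj) (use T in \<open>simp add: g bounded_ops_def\<close>)
  then have "Blinfun g \<in> bounded_ops"
    by (simp add: bounded_ops_def bounded_linear_Blinfun_apply [OF lin])
  moreover have "Blinfun g o\<^sub>L T = id_blinfun" "T o\<^sub>L Blinfun g = id_blinfun"
    using inj [OF g]
    by (simp_all add: blinfun_eq_iff g bounded_linear_Blinfun_apply [OF lin])
  ultimately show ?thesis
    by (auto simp: invertible_op_def)
qed

interpretation blinfun_compose: bounded_bilinear "(o\<^sub>L)"
  by (rule bounded_bilinear_blinfun_compose)

lemma blinfun_compose_assoc: "(R o\<^sub>L S) o\<^sub>L T = R o\<^sub>L (S o\<^sub>L T)"
  by (rule blinfun_eqI) simp

lemma id_blinfun_compose [simp]: "id_blinfun o\<^sub>L T = T" "T o\<^sub>L id_blinfun = T"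
  by (rule blinfun_eqI, simp)+

lemma invertible_op_compose:
  assumes "invertible_op S" "invertible_op T"
  shows "invertible_op (S o\<^sub>L T)"
proof -
  obtain S' T' where *: "S' \<in> bounded_ops" "S' o\<^sub>L S = id_blinfun" "S o\<^sub>L S' = id_blinfun"
    "T' \<in> bounded_ops" "T' o\<^sub>L T = id_blinfun" "T o\<^sub>L T' = id_blinfun"
    using assms unfolding invertible_op_def by blast
  have "(T' o\<^sub>L S') o\<^sub>L (S o\<^sub>L T) = T' o\<^sub>L ((S' o\<^sub>L S) o\<^sub>L T)"
    "(S o\<^sub>L T) o\<^sub>L (T' o\<^sub>L S') = S o\<^sub>L ((T o\<^sub>L T') o\<^sub>L S')"
    by (simp_all add: blinfun_compose_assoc)
  then show ?thesis
    using * unfolding invertible_op_def by (intro bexI [of _ "T' o\<^sub>L S'"]) auto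
qed

text \<open>The equation \<open>T x = y\<close> says that \<open>x\<close> is a fixed point of \<open>x \<mapsto> x - t(T x - y)\<close>. As
  \<open>\<parallel>x - t T x\<parallel>\<^sup>2 \<le> (1 - 2tm + t\<^sup>2K\<^sup>2)\<parallel>x\<parallel>\<^sup>2\<close>, this map is a contraction for
  \<open>t = m / K\<^sup>2\<close>.\<close>

lemma coercive_invertible:
  fixes T :: "'a::complex_hilbert_space \<Rightarrow>\<^sub>L 'a"
  assumes T: "T \<in> bounded_ops" and "m > 0"
    and coercive: "\<And>x. m * (norm x)\<^sup>2 \<le> Re (cinner (blinfun_apply T x) x)"
  shows "invertible_op T"
proof (rule invertible_opI [OF T \<open>m > 0\<close>])
  show "m * norm x \<le> norm (blinfun_apply T x)" for x
  proof (cases "x = 0")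
    case False
    have "m * (norm x)\<^sup>2 \<le> norm (blinfun_apply T x) * norm x"
      using coercive cinner_Cauchy_Schwarz complex_Re_le_cmod order_trans by meson
    then show ?thesis using False by (simp add: power2_eq_square)
  qed simp
next
  fix y
  \<comment> \<open>The maximum keeps \<open>K\<close> positive and \<open>m\<^sup>2 / K\<^sup>2 \<le> 1\<close>.\<close>
  define K where "K = max (norm T) m"
  define t where "t = m / K\<^sup>2"
  have K: "K > 0" "norm T \<le> K" "m \<le> K" using \<open>m > 0\<close> by (auto simp: K_def)
  have "t > 0" using K \<open>m > 0\<close> by (simp add: t_def)
  define c where "c = sqrt (1 - m\<^sup>2 / K\<^sup>2)"
  have q: "0 \<le> 1 - m\<^sup>2 / K\<^sup>2" "1 - m\<^sup>2 / K\<^sup>2 < 1"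
    using K \<open>m > 0\<close> by (auto simp: power_mono)
  have contract: "norm (x - t *\<^sub>R blinfun_apply T x) \<le> c * norm x" for x
  proof (rule power2_le_imp_le)
    have "(norm (blinfun_apply T x))\<^sup>2 \<le> (K * norm x)\<^sup>2"
      using order_trans [OF norm_blinfun [of T x] mult_right_mono [OF K(2) norm_ge_zero]]
      by (intro power_mono) auto
    then have "t\<^sup>2 * (norm (blinfun_apply T x))\<^sup>2 \<le> t\<^sup>2 * (K * norm x)\<^sup>2"
      by (intro mult_left_mono) auto
    moreover have "t * (m * (norm x)\<^sup>2) \<le> t * Re (cinner (blinfun_apply T x) x)"
      using coercive \<open>t > 0\<close> by (intro mult_left_mono) auto
    moreover have "(norm (x - t *\<^sub>R blinfun_apply T x))\<^sup>2
      = (norm x)\<^sup>2 - 2 * (t * Re (cinner (blinfun_apply T x) x))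
        + t\<^sup>2 * (norm (blinfun_apply T x))\<^sup>2"
      by (simp add: norm_diff_squared cinner_simps Re_cinner_commute [of x] power_mult_distrib)
    moreover have "(norm x)\<^sup>2 - 2 * (t * (m * (norm x)\<^sup>2)) + t\<^sup>2 * (K * norm x)\<^sup>2
      = (1 - m\<^sup>2 / K\<^sup>2) * (norm x)\<^sup>2"
      using K by (simp add: t_def field_simps power2_eq_square)
    moreover have "(c * norm x)\<^sup>2 = (1 - m\<^sup>2 / K\<^sup>2) * (norm x)\<^sup>2"
      unfolding power_mult_distrib c_def by (subst real_sqrt_pow2 [OF q(1)]) simp
    ultimately show "(norm (x - t *\<^sub>R blinfun_apply T x))\<^sup>2 \<le> (c * norm x)\<^sup>2"
      by linarith
  qed (use q in \<open>simp add: c_def\<close>)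
  have "\<exists>!x. x - t *\<^sub>R (blinfun_apply T x - y) = x"
  proof (rule banach_fix_type [of c])
    show "0 \<le> c" "c < 1"
      using q unfolding c_def real_sqrt_ge_0_iff real_sqrt_lt_1_iff by auto
    show "\<forall>x z. dist (x - t *\<^sub>R (blinfun_apply T x - y)) (z - t *\<^sub>R (blinfun_apply T z - y))
      \<le> c * dist x z"
    proof (intro allI)
      fix x z
      show "dist (x - t *\<^sub>R (blinfun_apply T x - y)) (z - t *\<^sub>R (blinfun_apply T z - y))
        \<le> c * dist x z"
        using contract [of "x - z"] by (simp add: dist_norm blinfun.diff_right algebra_simps)
    qed
  qed
  then show "\<exists>x. blinfun_apply T x = y" using \<open>t > 0\<close> by auto
qed

section \<open>Self-adjoint operators and their norm\<close>

definition self_adjoint :: "('a::complex_hilbert_space \<Rightarrow>\<^sub>L 'a) \<Rightarrow> bool" where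
  "self_adjoint T \<longleftrightarrow> T \<in> bounded_ops \<and>
     (\<forall>x y. cinner (blinfun_apply T x) y = cinner x (blinfun_apply T y))"

lemma self_adjointD:
  assumes "self_adjoint T"
  shows "T \<in> bounded_ops"
    and "cinner (blinfun_apply T x) y = cinner x (blinfun_apply T y)"
  using assms by (auto simp: self_adjoint_def)

lemma self_adjoint_id: "self_adjoint id_blinfun"
  by (simp add: self_adjoint_def)

lemma self_adjoint_add: "self_adjoint S \<Longrightarrow> self_adjoint T \<Longrightarrow> self_adjoint (S + T)"
  by (auto simp: self_adjoint_def blinfun.add_left cinner_simps)

lemma self_adjoint_diff: "self_adjoint S \<Longrightarrow> self_adjoint T \<Longrightarrow> self_adjoint (S - T)"
  by (auto simp: self_adjoint_def blinfun.diff_left cinner_simps)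

lemma self_adjoint_scaleR: "self_adjoint T \<Longrightarrow> self_adjoint (t *\<^sub>R T)"
  by (auto simp: self_adjoint_def blinfun.scaleR_left cinner_simps)

lemma self_adjoint_compose:
  "self_adjoint S \<Longrightarrow> self_adjoint T \<Longrightarrow> S o\<^sub>L T = T o\<^sub>L S \<Longrightarrow> self_adjoint (S o\<^sub>L T)"
  by (auto simp: self_adjoint_def bounded_ops_compose) (metis blinfun_apply_blinfun_compose)

text \<open>Since \<open>\<parallel>(S\<^sup>2 - n\<^sup>2)x\<parallel>\<^sup>2 \<le> n\<^sup>2(n\<^sup>2\<parallel>x\<parallel>\<^sup>2 - \<parallel>S x\<parallel>\<^sup>2)\<close> for \<open>n = \<parallel>S\<parallel>\<close>, a lower bound for
  \<open>S\<^sup>2 - n\<^sup>2 = (S - n)(S + n)\<close> would push \<open>\<parallel>S\<parallel>\<close> below \<open>n\<close>. Hence \<open>n\<close> or \<open>-n\<close> is in the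
  spectrum of a nonzero \<open>S\<close>.\<close>

lemma norm_le_of_real_resolvent:
  fixes S :: "'a::complex_hilbert_space \<Rightarrow>\<^sub>L 'a"
  assumes S: "self_adjoint S" and "0 \<le> K"
    and inv: "\<And>c. K < \<bar>c\<bar> \<Longrightarrow> invertible_op (S - c *\<^sub>R id_blinfun)"
  shows "norm S \<le> K"
proof (rule ccontr)
  define n where "n = norm S"
  assume "\<not> norm S \<le> K"
  then have "n > K" "n > 0" using \<open>0 \<le> K\<close> by (auto simp: n_def)
  have "invertible_op ((S - n *\<^sub>R id_blinfun) o\<^sub>L (S - (- n) *\<^sub>R id_blinfun))"
    using \<open>n > K\<close> \<open>0 \<le> K\<close> by (intro invertible_op_compose inv) auto
  then obtain c where "c > 0"
    and c: "\<And>x. c * norm x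
      \<le> norm (blinfun_apply ((S - n *\<^sub>R id_blinfun) o\<^sub>L (S - (- n) *\<^sub>R id_blinfun)) x)"
    using invertible_bounded_below by blast
  have strict: "(norm (blinfun_apply S x))\<^sup>2 \<le> (n\<^sup>2 - c\<^sup>2 / n\<^sup>2) * (norm x)\<^sup>2" for x
  proof -
    let ?Sx = "blinfun_apply S x"
    have "blinfun_apply ((S - n *\<^sub>R id_blinfun) o\<^sub>L (S - (- n) *\<^sub>R id_blinfun)) x
        = blinfun_apply S ?Sx - n\<^sup>2 *\<^sub>R x"
      by (simp add: blinfun.diff_left blinfun.add_left blinfun.scaleR_left blinfun.add_right
          blinfun.scaleR_right scaleR_diff_right scaleR_add_right power2_eq_square)
    then have "(c * norm x)\<^sup>2 \<le> (norm (blinfun_apply S ?Sx - n\<^sup>2 *\<^sub>R x))\<^sup>2"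
      using c [of x] \<open>c > 0\<close> by (intro power_mono) auto
    also have "\<dots> = (norm (blinfun_apply S ?Sx))\<^sup>2 - 2 * n\<^sup>2 * (norm ?Sx)\<^sup>2 + n ^ 4 * (norm x)\<^sup>2"
      by (simp add: norm_diff_squared cinner_simps self_adjointD(2) [OF S] cinner_self
          power_mult_distrib)
    also have "\<dots> \<le> n\<^sup>2 * (norm ?Sx)\<^sup>2 - 2 * n\<^sup>2 * (norm ?Sx)\<^sup>2 + n ^ 4 * (norm x)\<^sup>2"
      using power_mono [OF norm_blinfun [of S ?Sx], of 2]
      by (simp add: n_def power_mult_distrib)
    finally have "n\<^sup>2 * (norm ?Sx)\<^sup>2 \<le> n ^ 4 * (norm x)\<^sup>2 - c\<^sup>2 * (norm x)\<^sup>2"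
      by (simp add: power_mult_distrib)
    also have "\<dots> = n\<^sup>2 * ((n\<^sup>2 - c\<^sup>2 / n\<^sup>2) * (norm x)\<^sup>2)"
    proof -
      have "n ^ 4 = n\<^sup>2 * n\<^sup>2" by (simp flip: power_add)
      then show ?thesis using \<open>n > 0\<close> by (simp add: right_diff_distrib left_diff_distrib)
    qed
    finally show ?thesis
      using \<open>n > 0\<close> mult_le_cancel_left_pos [of "n\<^sup>2"] by (metis zero_less_power)
  qed
  define q where "q = n\<^sup>2 - c\<^sup>2 / n\<^sup>2"
  have "q < n\<^sup>2" using \<open>c > 0\<close> \<open>n > 0\<close> by (simp add: q_def)
  have "norm S \<le> sqrt \<bar>q\<bar>"
  proof (rule norm_blinfun_bound)
    fix x
    have "(norm (blinfun_apply S x))\<^sup>2 \<le> (sqrt \<bar>q\<bar> * norm x)\<^sup>2"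
      using strict [of x] mult_right_mono [OF abs_ge_self [of q], of "(norm x)\<^sup>2"]
      by (simp add: q_def power_mult_distrib)
    then show "norm (blinfun_apply S x) \<le> sqrt \<bar>q\<bar> * norm x"
      by (rule power2_le_imp_le) simp
  qed simp
  moreover have "\<bar>q\<bar> < n\<^sup>2"
  proof -
    have "S \<noteq> 0" using \<open>n > 0\<close> by (auto simp: n_def)
    then obtain x where "blinfun_apply S x \<noteq> blinfun_apply 0 x"
      using blinfun_eqI by blast
    then have "x \<noteq> 0" by auto
    then have "0 \<le> q"
      using order_trans [OF zero_le_power2 strict [of x]] by (simp add: q_def zero_le_mult_iff)
    then show ?thesis using \<open>q < n\<^sup>2\<close> by simp
  qed
  then have "sqrt \<bar>q\<bar> < n" 
    using \<open>n > 0\<close> by (simp add: real_less_lsqrt)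
  ultimately show False by (simp add: n_def)
qed

section \<open>Polynomials of an operator\<close>

lemma op_poly_0 [simp]: "op_poly 0 T = 0"
  by (simp add: op_poly_def)

lemma op_poly_pCons:
  "op_poly (pCons a p) T = a *\<^sub>R id_blinfun + (T o\<^sub>L op_poly p T)"
proof (cases "p = 0")
  case True
  then show ?thesis by (cases "a = 0") (simp_all add: op_poly_def)
next
  case False
  have "op_poly (pCons a p) T
      = a *\<^sub>R id_blinfun + (\<Sum>i\<le>degree p. coeff p i *\<^sub>R (T o\<^sub>L (((o\<^sub>L) T) ^^ i) id_blinfun))"
    using False by (simp add: op_poly_def sum.atMost_Suc_shift del: sum.atMost_Suc)
  also have "\<dots> = a *\<^sub>R id_blinfun + (T o\<^sub>L op_poly p T)"
    by (simp add: op_poly_def blinfun_compose.sum_right blinfun_compose.scaleR_right)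
  finally show ?thesis .
qed

lemma op_poly_const: "op_poly [:a:] T = a *\<^sub>R id_blinfun"
  by (simp add: op_poly_pCons)

lemma op_poly_linear: "op_poly [:a, b:] T = a *\<^sub>R id_blinfun + b *\<^sub>R T"
  by (simp add: op_poly_pCons blinfun_compose.scaleR_right)

lemma op_poly_add: "op_poly (p + q) T = op_poly p T + op_poly q T"
  by (induction p q rule: poly_induct2)
    (simp_all add: op_poly_pCons scaleR_add_left blinfun_compose.add_right)

lemma op_poly_smult: "op_poly (smult c p) T = c *\<^sub>R op_poly p T"
  by (induction p)
    (simp_all add: op_poly_pCons scaleR_add_right blinfun_compose.scaleR_right)

lemma op_poly_diff: "op_poly (p - q) T = op_poly p T - op_poly q T"
  using op_poly_add [of p "smult (-1) q" T] op_poly_smult [of "-1" q T] by simp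

lemma op_poly_mult: "op_poly (p * q) T = op_poly p T o\<^sub>L op_poly q T"
  by (induction p)
    (simp_all add: op_poly_pCons op_poly_add op_poly_smult blinfun_compose.add_left
      blinfun_compose.scaleR_left blinfun_compose_assoc)

lemma op_poly_intertwine:
  assumes "X o\<^sub>L T = T' o\<^sub>L X"
  shows "X o\<^sub>L op_poly p T = op_poly p T' o\<^sub>L X"
proof (induction p)
  case (pCons a p)
  have "X o\<^sub>L (T o\<^sub>L op_poly p T) = T' o\<^sub>L (X o\<^sub>L op_poly p T)"
    by (metis assms blinfun_compose_assoc)
  then show ?case
    by (simp add: op_poly_pCons blinfun_compose.add_left blinfun_compose.add_right
        blinfun_compose.scaleR_left blinfun_compose.scaleR_right pCons.IH blinfun_compose_assoc)
qed simp

lemma self_adjoint_0: "self_adjoint 0"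
  by (simp add: self_adjoint_def bounded_ops_def)
    (metis bounded_bilinear.zero_left bounded_bilinear.zero_right bounded_bilinear_cinner
      scaleC_diff_right diff_self)

lemma self_adjoint_op_poly:
  assumes "self_adjoint T"
  shows "self_adjoint (op_poly p T)"
proof (induction p)
  case (pCons a p)
  have "T o\<^sub>L op_poly p T = op_poly p T o\<^sub>L T"
    by (rule op_poly_intertwine) simp
  then show ?case
    using pCons.IH assms by (auto simp: op_poly_pCons
        intro!: self_adjoint_add self_adjoint_scaleR self_adjoint_id self_adjoint_compose)
qed (simp add: self_adjoint_0)

section \<open>The real spectrum and the norm of a polynomial\<close>

definition real_spectrum :: "('a::complex_hilbert_space \<Rightarrow>\<^sub>L 'a) \<Rightarrow> real set" where
  "real_spectrum T = {t. complex_of_real t \<in> op_spectrum T}"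

lemma not_in_real_spectrum_iff:
  "t \<notin> real_spectrum T \<longleftrightarrow> invertible_op (T - t *\<^sub>R id_blinfun)"
proof -
  have "invertible_op (T - t *\<^sub>R id_blinfun) \<longleftrightarrow> (\<exists>S\<in>bounded_ops. \<forall>x.
     blinfun_apply S (blinfun_apply T x - t *\<^sub>R x) = x \<and>
     blinfun_apply T (blinfun_apply S x) - t *\<^sub>R blinfun_apply S x = x)"
    unfolding invertible_op_def blinfun_eq_iff
    by (simp add: blinfun.diff_left blinfun.scaleR_left all_conj_distrib)
  then show ?thesis
    by (simp add: real_spectrum_def op_spectrum_def scaleC_of_real)
qed

lemma invertible_op_scaleR:
  assumes "invertible_op T" "c \<noteq> 0"
  shows "invertible_op (c *\<^sub>R T)"
proof -
  obtain S where "S \<in> bounded_ops" "S o\<^sub>L T = id_blinfun" "T o\<^sub>L S = id_blinfun"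
    using assms by (auto simp: invertible_op_def)
  then show ?thesis
    using \<open>c \<noteq> 0\<close> unfolding invertible_op_def
    by (intro bexI [of _ "(1 / c) *\<^sub>R S"])
      (auto simp: blinfun_compose.scaleR_left blinfun_compose.scaleR_right)
qed

lemma invertible_op_id: "invertible_op id_blinfun"
  unfolding invertible_op_def by (intro bexI [of _ id_blinfun]) auto

lemma quadratic_invertible:
  assumes T: "self_adjoint T" and "b \<noteq> 0"
  shows "invertible_op (op_poly [:a\<^sup>2 + b\<^sup>2, - 2 * a, 1:] T)"
proof (rule coercive_invertible)
  show "op_poly [:a\<^sup>2 + b\<^sup>2, - 2 * a, 1:] T \<in> bounded_ops"
    by (rule self_adjointD [OF self_adjoint_op_poly [OF T]])
  show "0 < b\<^sup>2" using \<open>b \<noteq> 0\<close> by simp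
  fix x
  define S where "S = T - a *\<^sub>R id_blinfun"
  have S: "self_adjoint S"
    unfolding S_def using T by (intro self_adjoint_diff self_adjoint_scaleR self_adjoint_id)
  have "[:a\<^sup>2 + b\<^sup>2, - 2 * a, 1:] = [:- a, 1:] * [:- a, 1:] + [:b\<^sup>2:]"
    by (simp add: power2_eq_square)
  then have "op_poly [:a\<^sup>2 + b\<^sup>2, - 2 * a, 1:] T = (S o\<^sub>L S) + b\<^sup>2 *\<^sub>R id_blinfun"
    by (simp only: op_poly_add op_poly_mult op_poly_linear op_poly_const S_def)
      (simp add: algebra_simps)
  then have "Re (cinner (blinfun_apply (op_poly [:a\<^sup>2 + b\<^sup>2, - 2 * a, 1:] T) x) x)
      = (norm (blinfun_apply S x))\<^sup>2 + b\<^sup>2 * (norm x)\<^sup>2"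
    by (simp add: blinfun.add_left blinfun.scaleR_left cinner_simps
        self_adjointD(2) [OF S] norm_eq_Re_cinner)
  then show "b\<^sup>2 * (norm x)\<^sup>2
      \<le> Re (cinner (blinfun_apply (op_poly [:a\<^sup>2 + b\<^sup>2, - 2 * a, 1:] T) x) x)"
    by simp
qed

text \<open>The roots come from the fundamental theorem of algebra, so real polynomials have to be
  evaluated at complex points. This evaluation is a ring homomorphism.\<close>

lemma poly_of_real_pCons:
  "poly (map_poly complex_of_real (pCons a p)) z
     = complex_of_real a + z * poly (map_poly complex_of_real p) z"
  by (simp add: map_poly_pCons)

lemma poly_of_real_add:
  "poly (map_poly complex_of_real (p + q)) z
     = poly (map_poly complex_of_real p) z + poly (map_poly complex_of_real q) z"
  by (induction p q rule: poly_induct2) (simp_all add: poly_of_real_pCons algebra_simps)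

lemma poly_of_real_smult:
  "poly (map_poly complex_of_real (smult c p)) z
     = complex_of_real c * poly (map_poly complex_of_real p) z"
  by (induction p) (simp_all add: poly_of_real_pCons algebra_simps)

lemma poly_of_real_mult:
  "poly (map_poly complex_of_real (p * q)) z
     = poly (map_poly complex_of_real p) z * poly (map_poly complex_of_real q) z"
  by (induction p)
    (simp_all add: poly_of_real_pCons poly_of_real_add poly_of_real_smult algebra_simps)

lemma poly_of_real_of_real:
  "poly (map_poly complex_of_real p) (complex_of_real t) = complex_of_real (poly p t)"
  by (induction p) (simp_all add: poly_of_real_pCons)

text \<open>The remainder of \<open>p\<close> modulo the quadratic is a real linear polynomial with the nonreal root
  \<open>z\<close>, hence zero.\<close>

lemma real_quadratic_factor:
  fixes p :: "real poly"
  assumes root: "poly (map_poly complex_of_real p) z = 0" and "Im z \<noteq> 0"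
  shows "[:(Re z)\<^sup>2 + (Im z)\<^sup>2, - 2 * Re z, 1:] dvd p"
proof -
  let ?q = "[:(Re z)\<^sup>2 + (Im z)\<^sup>2, - 2 * Re z, 1:]"
  define s where "s = p mod ?q"
  have "p = ?q * (p div ?q) + s" unfolding s_def by (rule mult_div_mod_eq [symmetric])
  then have "poly (map_poly complex_of_real p) z
      = poly (map_poly complex_of_real ?q) z * poly (map_poly complex_of_real (p div ?q)) z
        + poly (map_poly complex_of_real s) z"
    by (metis poly_of_real_add poly_of_real_mult)
  moreover have "poly (map_poly complex_of_real ?q) z = 0"
    by (simp add: poly_of_real_pCons complex_eq_iff power2_eq_square algebra_simps)
  ultimately have s_root: "poly (map_poly complex_of_real s) z = 0"
    using root by simp
  have "degree s < 2"
    using degree_mod_less' [of ?q p] by (cases "s = 0") (auto simp: s_def)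
  then obtain a b where s: "s = [:a, b:]"
    by (metis degree_eq_zeroE degree_pCons_eq_if less_2_cases_iff pCons_cases Suc_inject pCons_0_0
        One_nat_def)
  have "b * Im z = 0" "a + b * Re z = 0"
    using s_root by (auto simp: s poly_of_real_pCons complex_eq_iff mult.commute)
  then have "s = 0" using \<open>Im z \<noteq> 0\<close> by (simp add: s)
  then show ?thesis by (simp add: s_def mod_eq_0_iff_dvd)
qed

text \<open>Over the reals a polynomial splits into factors \<open>t - a\<close> and \<open>(t - a)\<^sup>2 + b\<^sup>2\<close> with
  \<open>b \<noteq> 0\<close>. The former give invertible operators by assumption, the latter by coercivity.\<close>

lemma op_poly_invertible:
  assumes T: "self_adjoint T" and "q \<noteq> 0"
    and "\<And>t. t \<in> real_spectrum T \<Longrightarrow> poly q t \<noteq> 0"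
  shows "invertible_op (op_poly q T)"
  using assms(2,3)
proof (induction "degree q" arbitrary: q rule: less_induct)
  case less
  show ?case
  proof (cases "degree q = 0")
    case True
    then obtain a where "q = [:a:]" by (metis degree_eq_zeroE)
    then show ?thesis
      using \<open>q \<noteq> 0\<close> by (simp add: op_poly_const invertible_op_scaleR invertible_op_id)
  next
    case False
    have "\<exists>f g. q = f * g \<and> degree f > 0 \<and> invertible_op (op_poly f T)"
    proof (cases "\<exists>t. poly q t = 0")
      case True
      then obtain t g where t: "poly q t = 0" and "q = [:- t, 1:] * g"
        by (metis dvdE poly_eq_0_iff_dvd)
      moreover have "invertible_op (op_poly [:- t, 1:] T)"
        using less.prems(2) [of t] t not_in_real_spectrum_iff [of t T]
        by (auto simp: op_poly_linear)
      ultimately show ?thesis by fastforce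
    next
      case no_real: False
      have "degree (map_poly complex_of_real q) \<noteq> 0"
        using False by (simp add: degree_map_poly)
      then have "\<not> constant (poly (map_poly complex_of_real q))"
        by (simp add: constant_degree)
      then obtain z where z: "poly (map_poly complex_of_real q) z = 0"
        using fundamental_theorem_of_algebra by blast
      have "Im z \<noteq> 0"
      proof
        assume "Im z = 0"
        then have "z = complex_of_real (Re z)" by (simp add: complex_eq_iff)
        then show False using z no_real poly_of_real_of_real [of q "Re z"] by simp
      qed
      then obtain g where "q = [:(Re z)\<^sup>2 + (Im z)\<^sup>2, - 2 * Re z, 1:] * g"
        using real_quadratic_factor [OF z] by (metis dvdE)
      then show ?thesis
        using quadratic_invertible [OF T \<open>Im z \<noteq> 0\<close>, of "Re z"] by fastforce
    qed
    then obtain f g where fg: "q = f * g" "degree f > 0" "invertible_op (op_poly f T)"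
      by blast
    then have "f \<noteq> 0" "g \<noteq> 0" using \<open>q \<noteq> 0\<close> by auto
    then have "invertible_op (op_poly g T)"
      using fg less.prems by (intro less.hyps) (auto simp: degree_mult_eq)
    then show ?thesis
      by (simp add: fg op_poly_mult invertible_op_compose)
  qed
qed

text \<open>An empty real spectrum would force \<open>T = 0\<close>, whose spectrum contains \<open>0\<close> unless the space
  is trivial.\<close>

lemma real_spectrum_empty_trivial:
  fixes T :: "'a::complex_hilbert_space \<Rightarrow>\<^sub>L 'a" and x :: 'a
  assumes T: "self_adjoint T" and "real_spectrum T = {}"
  shows "x = 0"
proof -
  have inv: "invertible_op (T - c *\<^sub>R id_blinfun)" for c
    using assms(2) not_in_real_spectrum_iff by blast
  then have "norm T \<le> 0"
    by (intro norm_le_of_real_resolvent [OF T]) auto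
  then have "invertible_op (0 :: 'a \<Rightarrow>\<^sub>L 'a)"
    using inv [of 0] by simp
  then obtain c where "c > 0" "c * norm x \<le> norm (blinfun_apply (0 :: 'a \<Rightarrow>\<^sub>L 'a) x)"
    using invertible_bounded_below by blast
  then show ?thesis by (simp add: mult_le_0_iff)
qed

text \<open>If \<open>\<bar>c\<bar> > K\<close> then \<open>p - c\<close> has no root in the spectrum, so \<open>p(T) - c\<close> is
  invertible: the real spectrum of \<open>p(T)\<close> lies in \<open>[-K, K]\<close>.\<close>

lemma norm_op_poly_le:
  assumes T: "self_adjoint T" and "0 \<le> K"
    and K: "\<And>t. t \<in> real_spectrum T \<Longrightarrow> \<bar>poly p t\<bar> \<le> K"
  shows "norm (op_poly p T) \<le> K"
proof (cases "real_spectrum T = {}")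
  case True
  then have "op_poly p T = 0"
    using real_spectrum_empty_trivial [OF T] by (metis blinfun_eqI)
  then show ?thesis using \<open>0 \<le> K\<close> by simp
next
  case False
  show ?thesis
  proof (rule norm_le_of_real_resolvent [OF self_adjoint_op_poly [OF T] \<open>0 \<le> K\<close>])
    fix c :: real assume "K < \<bar>c\<bar>"
    then have nz: "poly (p - [:c:]) t \<noteq> 0" if "t \<in> real_spectrum T" for t
      using K [OF that] by auto
    moreover have "p - [:c:] \<noteq> 0"
      using nz False by (metis all_not_in_conv poly_0)
    ultimately have "invertible_op (op_poly (p - [:c:]) T)"
      by (intro op_poly_invertible [OF T]) auto
    then show "invertible_op (op_poly p T - c *\<^sub>R id_blinfun)"
      by (simp add: op_poly_diff op_poly_const)
  qed
qed

section \<open>Continuous functional calculus\<close>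

text \<open>The condition \<open>m \<le> T \<le> M\<close>. The interval \<open>[m, M]\<close> stands in for the spectrum as the
  domain of the functions applied to \<open>T\<close>: unlike the spectrum, it can be enlarged to serve two
  operators at once, and a positive \<open>m\<close> keeps powers continuous.\<close>

definition op_between :: "real \<Rightarrow> real \<Rightarrow> ('a::complex_hilbert_space \<Rightarrow>\<^sub>L 'a) \<Rightarrow> bool" where
  "op_between m M T \<longleftrightarrow> self_adjoint T \<and>
     (\<forall>x. m * (norm x)\<^sup>2 \<le> Re (cinner (blinfun_apply T x) x) \<and>
          Re (cinner (blinfun_apply T x) x) \<le> M * (norm x)\<^sup>2)"

lemma op_betweenD:
  assumes "op_between m M T"
  shows "self_adjoint T"
    and "m * (norm x)\<^sup>2 \<le> Re (cinner (blinfun_apply T x) x)"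
    and "Re (cinner (blinfun_apply T x) x) \<le> M * (norm x)\<^sup>2"
  using assms by (auto simp: op_between_def)

lemma op_between_mono:
  assumes "op_between m M T" "m' \<le> m" "M \<le> M'"
  shows "op_between m' M' T"
  using assms unfolding op_between_def by (meson order_trans mult_right_mono zero_le_power2)

text \<open>For real \<open>t\<close> outside \<open>[m, M]\<close> one of \<open>T - t\<close> and \<open>t - T\<close> is coercive.\<close>

lemma real_spectrum_subset:
  assumes T: "op_between m M T"
  shows "real_spectrum T \<subseteq> {m..M}"
proof
  fix t assume t: "t \<in> real_spectrum T"
  have ops: "T - t *\<^sub>R id_blinfun \<in> bounded_ops"
    using self_adjointD(1) [OF op_betweenD(1) [OF T]]
    by (intro bounded_ops_diff bounded_ops_scaleR bounded_ops_id)
  have "m \<le> t"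
  proof (rule ccontr)
    assume "\<not> m \<le> t"
    then have "invertible_op (T - t *\<^sub>R id_blinfun)"
      using op_betweenD(2) [OF T] by (intro coercive_invertible [OF ops, of "m - t"])
        (auto simp: blinfun.diff_left blinfun.scaleR_left cinner_simps cinner_self left_diff_distrib)
    then show False using t not_in_real_spectrum_iff by blast
  qed
  moreover have "t \<le> M"
  proof (rule ccontr)
    assume "\<not> t \<le> M"
    then have "invertible_op ((-1) *\<^sub>R (T - t *\<^sub>R id_blinfun))"
      using op_betweenD(3) [OF T] by (intro coercive_invertible [OF bounded_ops_scaleR [OF ops], of "t - M"])
        (auto simp: blinfun.diff_left blinfun.minus_left blinfun.scaleR_left cinner_simps cinner_self
          left_diff_distrib)
    from invertible_op_scaleR [OF this, of "-1"] show False
      using t not_in_real_spectrum_iff [of t T] by simp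
  qed
  ultimately show "t \<in> {m..M}" by simp
qed

text \<open>The bound \<open>\<parallel>p(T)\<parallel> \<le> sup \<bar>p\<bar>\<close> over the spectrum makes \<open>p\<^sub>n(T)\<close> Cauchy and its limit
  independent of the approximating sequence; this is what the definite description in
  \<^const>\<open>cont_fun_calc\<close> requires.\<close>

lemma cont_fun_calc_limit:
  assumes T: "op_between m M T" and p: "uniform_limit {m..M} (\<lambda>n. poly (p n)) f sequentially"
  shows "(\<lambda>n. op_poly (p n) T) \<longlonglongrightarrow> cont_fun_calc f T"
proof -
  note sa = op_betweenD(1) [OF T]
  have close: "norm (op_poly a T - op_poly b T) < e"
    if "0 < e" and a: "\<forall>t\<in>real_spectrum T. dist (poly a t) (f t) < e / 4"
      and b: "\<forall>t\<in>real_spectrum T. dist (poly b t) (f t) < e / 4" for a b e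
  proof -
    have "norm (op_poly (a - b) T) \<le> e / 2"
    proof (rule norm_op_poly_le [OF sa])
      fix t assume "t \<in> real_spectrum T"
      then have "dist (poly a t) (f t) < e / 4" "dist (poly b t) (f t) < e / 4"
        using a b by auto
      then show "\<bar>poly (a - b) t\<bar> \<le> e / 2"
        unfolding dist_real_def poly_diff by linarith
    qed (use \<open>0 < e\<close> in simp)
    then show ?thesis using \<open>0 < e\<close> by (simp add: op_poly_diff)
  qed
  have p': "uniform_limit (real_spectrum T) (\<lambda>n. poly (p n)) f sequentially"
    using p real_spectrum_subset [OF T] by (rule uniform_limit_on_subset)
  have "Cauchy (\<lambda>n. op_poly (p n) T)"
  proof (rule metric_CauchyI)
    fix e :: real assume "0 < e"
    then obtain N where "\<And>n. n \<ge> N \<Longrightarrow> \<forall>t\<in>real_spectrum T. dist (poly (p n) t) (f t) < e / 4"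
      using uniform_limitD [OF p', of "e / 4"] by (auto simp: eventually_sequentially)
    then show "\<exists>N. \<forall>k\<ge>N. \<forall>n\<ge>N. dist (op_poly (p k) T) (op_poly (p n) T) < e"
      using close [OF \<open>0 < e\<close>] by (auto simp: dist_norm intro!: exI [of _ N])
  qed
  then obtain S where S: "(\<lambda>n. op_poly (p n) T) \<longlonglongrightarrow> S"
    using Cauchy_convergent convergent_def by blast
  have "cont_fun_calc f T = S"
    unfolding cont_fun_calc_def real_spectrum_def [symmetric]
  proof (rule the_equality)
    show "\<forall>q. uniform_limit (real_spectrum T) (\<lambda>n. poly (q n)) f sequentially
        \<longrightarrow> (\<lambda>n. op_poly (q n) T) \<longlonglongrightarrow> S"
    proof (intro allI impI)
      fix q assume q: "uniform_limit (real_spectrum T) (\<lambda>n. poly (q n :: real poly)) f sequentially"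
      have "(\<lambda>n. op_poly (q n) T - op_poly (p n) T) \<longlonglongrightarrow> 0"
      proof (rule tendstoI)
        fix e :: real assume "0 < e"
        then have "0 < e / 4" by simp
        from uniform_limitD [OF q this] uniform_limitD [OF p' this]
        show "\<forall>\<^sub>F n in sequentially. dist (op_poly (q n) T - op_poly (p n) T) 0 < e"
          by eventually_elim (use close [OF \<open>0 < e\<close>] in simp)
      qed
      from tendsto_add [OF this S] show "(\<lambda>n. op_poly (q n) T) \<longlonglongrightarrow> S" by simp
    qed
    fix S' assume "\<forall>q. uniform_limit (real_spectrum T) (\<lambda>n. poly (q n)) f sequentially
        \<longrightarrow> (\<lambda>n. op_poly (q n) T) \<longlonglongrightarrow> S'"
    then show "S' = S" using p' S LIMSEQ_unique by blast
  qed
  then show ?thesis using S by simp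
qed

lemma polynomial_approximation:
  fixes f :: "real \<Rightarrow> real"
  assumes "continuous_on {m..M} f"
  obtains p where "uniform_limit {m..M} (\<lambda>n. poly (p n)) f sequentially"
proof -
  obtain g where g: "uniform_limit {m..M} g f sequentially" "\<And>n::nat. polynomial_function (g n)"
    using Stone_Weierstrass_uniform_limit [OF compact_Icc assms] by blast
  have "\<exists>p. g n = poly p" for n
  proof -
    obtain a k where "g n = (\<lambda>x. \<Sum>i\<le>k. a i * x ^ i)"
      using g(2) [of n] by (auto simp: real_polynomial_function_iff_sum simp flip: real_polynomial_function_eq)
    then have "g n = poly (\<Sum>i\<le>k. monom (a i) i)"
      by (simp add: fun_eq_iff poly_sum poly_monom)
    then show ?thesis ..
  qed
  then obtain p where "\<And>n. g n = poly (p n)" by metis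
  then have "g = (\<lambda>n. poly (p n))" by (simp add: fun_eq_iff)
  then show ?thesis using g(1) that by blast
qed

lemma cont_fun_calc_unique:
  assumes "op_between m M T" "uniform_limit {m..M} (\<lambda>n. poly (p n)) f sequentially"
    and "(\<lambda>n. op_poly (p n) T) \<longlonglongrightarrow> S"
  shows "cont_fun_calc f T = S"
  using cont_fun_calc_limit [OF assms(1,2)] assms(3) LIMSEQ_unique by blast

lemma cont_fun_calc_poly:
  assumes "op_between m M T"
  shows "cont_fun_calc (poly p) T = op_poly p T"
proof (rule cont_fun_calc_unique [OF assms])
  show "uniform_limit {m..M} (\<lambda>n::nat. poly p) (poly p) sequentially"
    by (rule uniform_limit_const)
qed simp

lemma cont_fun_calc_const: "op_between m M T \<Longrightarrow> cont_fun_calc (\<lambda>t. c) T = c *\<^sub>R id_blinfun"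
  using cont_fun_calc_poly [of m M T "[:c:]"] by (simp add: op_poly_const poly_pCons [abs_def])

lemma cont_fun_calc_id: "op_between m M T \<Longrightarrow> cont_fun_calc (\<lambda>t. t) T = T"
  using cont_fun_calc_poly [of m M T "[:0, 1:]"] by (simp add: op_poly_linear poly_pCons [abs_def])

lemma cont_fun_calc_cong:
  assumes T: "op_between m M T" and "continuous_on {m..M} f"
    and eq: "\<And>t. t \<in> {m..M} \<Longrightarrow> f t = g t"
  shows "cont_fun_calc f T = cont_fun_calc g T"
proof -
  obtain p where p: "uniform_limit {m..M} (\<lambda>n. poly (p n)) f sequentially"
    using polynomial_approximation [OF assms(2)] .
  then have "uniform_limit {m..M} (\<lambda>n. poly (p n)) g sequentially"
    by (rule uniform_limit_cong' [THEN iffD1, rotated 2]) (simp_all add: eq)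
  from cont_fun_calc_unique [OF T this cont_fun_calc_limit [OF T p]] show ?thesis by simp
qed

context
  fixes m M :: real and T :: "'a::complex_hilbert_space \<Rightarrow>\<^sub>L 'a" and f :: "real \<Rightarrow> real"
  assumes T: "op_between m M T" and f: "continuous_on {m..M} f"
begin

lemma cont_fun_calc_add:
  assumes g: "continuous_on {m..M} g"
  shows "cont_fun_calc (\<lambda>t. f t + g t) T = cont_fun_calc f T + cont_fun_calc g T"
proof -
  obtain p where p: "uniform_limit {m..M} (\<lambda>n. poly (p n)) f sequentially"
    using polynomial_approximation [OF f] .
  obtain q where q: "uniform_limit {m..M} (\<lambda>n. poly (q n)) g sequentially"
    using polynomial_approximation [OF g] .
  show ?thesis
  proof (rule cont_fun_calc_unique [OF T, where p = "\<lambda>n. p n + q n"])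
    show "uniform_limit {m..M} (\<lambda>n. poly (p n + q n)) (\<lambda>t. f t + g t) sequentially"
      using uniform_limit_add [OF p q] by (simp add: poly_add [abs_def])
    show "(\<lambda>n. op_poly (p n + q n) T) \<longlonglongrightarrow> cont_fun_calc f T + cont_fun_calc g T"
      unfolding op_poly_add by (intro tendsto_add cont_fun_calc_limit [OF T] p q)
  qed
qed

lemma cont_fun_calc_mult:
  assumes g: "continuous_on {m..M} g"
  shows "cont_fun_calc (\<lambda>t. f t * g t) T = cont_fun_calc f T o\<^sub>L cont_fun_calc g T"
proof -
  obtain p where p: "uniform_limit {m..M} (\<lambda>n. poly (p n)) f sequentially"
    using polynomial_approximation [OF f] .
  obtain q where q: "uniform_limit {m..M} (\<lambda>n. poly (q n)) g sequentially"
    using polynomial_approximation [OF g] .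
  have bdd: "bounded (f ` {m..M})" "bounded (g ` {m..M})"
    by (auto intro!: compact_imp_bounded compact_continuous_image f g)
  show ?thesis
  proof (rule cont_fun_calc_unique [OF T, where p = "\<lambda>n. p n * q n"])
    show "uniform_limit {m..M} (\<lambda>n. poly (p n * q n)) (\<lambda>t. f t * g t) sequentially"
      using uniform_lim_mult [OF p q bdd] by (simp add: poly_mult [abs_def])
    show "(\<lambda>n. op_poly (p n * q n) T) \<longlonglongrightarrow> (cont_fun_calc f T o\<^sub>L cont_fun_calc g T)"
      unfolding op_poly_mult
      by (intro blinfun_compose.tendsto cont_fun_calc_limit [OF T] p q)
  qed
qed

lemma self_adjoint_cont_fun_calc: "self_adjoint (cont_fun_calc f T)"
proof -
  obtain p where p: "uniform_limit {m..M} (\<lambda>n. poly (p n)) f sequentially"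
    using polynomial_approximation [OF f] .
  note lim = cont_fun_calc_limit [OF T p]
  note sa = self_adjointD [OF self_adjoint_op_poly [OF op_betweenD(1) [OF T]]]
  have app: "(\<lambda>n. blinfun_apply (op_poly (p n) T) x) \<longlonglongrightarrow> blinfun_apply (cont_fun_calc f T) x" for x
    by (intro blinfun.tendsto lim tendsto_const)
  have "blinfun_apply (cont_fun_calc f T) (c *\<^sub>C x) = c *\<^sub>C blinfun_apply (cont_fun_calc f T) x" for c x
  proof (rule LIMSEQ_unique [OF app])
    have "bounded_linear ((*\<^sub>C) c :: 'a \<Rightarrow> 'a)"
      by standard (auto simp: scaleC_add_right scaleC_scaleR norm_scaleC intro!: exI [of _ "cmod c"])
    from bounded_linear.tendsto [OF this app]
    show "(\<lambda>n. blinfun_apply (op_poly (p n) T) (c *\<^sub>C x)) \<longlonglongrightarrow> c *\<^sub>C blinfun_apply (cont_fun_calc f T) x"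
      using sa(1) by (simp add: bounded_ops_def)
  qed
  moreover have "cinner (blinfun_apply (cont_fun_calc f T) x) y
      = cinner x (blinfun_apply (cont_fun_calc f T) y)" for x y
  proof (rule LIMSEQ_unique)
    show "(\<lambda>n. cinner (blinfun_apply (op_poly (p n) T) x) y)
        \<longlonglongrightarrow> cinner (blinfun_apply (cont_fun_calc f T) x) y"
      by (intro bounded_bilinear.tendsto [OF bounded_bilinear_cinner] app tendsto_const)
    show "(\<lambda>n. cinner (blinfun_apply (op_poly (p n) T) x) y)
        \<longlonglongrightarrow> cinner x (blinfun_apply (cont_fun_calc f T) y)"
      unfolding sa(2)
      by (intro bounded_bilinear.tendsto [OF bounded_bilinear_cinner] app tendsto_const)
  qed
  ultimately show ?thesis by (simp add: self_adjoint_def bounded_ops_def)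
qed

lemma norm_cont_fun_calc_le:
  assumes "0 \<le> K" and K: "\<And>t. t \<in> {m..M} \<Longrightarrow> \<bar>f t\<bar> \<le> K"
  shows "norm (cont_fun_calc f T) \<le> K"
proof (rule field_le_epsilon)
  fix e :: real assume "0 < e"
  obtain p where p: "uniform_limit {m..M} (\<lambda>n. poly (p n)) f sequentially"
    using polynomial_approximation [OF f] .
  have "\<forall>\<^sub>F n in sequentially. norm (op_poly (p n) T) \<le> K + e"
    using uniform_limitD [OF p \<open>0 < e\<close>]
  proof eventually_elim
    case (elim n)
    show ?case
    proof (rule norm_op_poly_le [OF op_betweenD(1) [OF T]])
      fix t assume "t \<in> real_spectrum T"
      then have "t \<in> {m..M}" using real_spectrum_subset [OF T] by blast
      then show "\<bar>poly (p n) t\<bar> \<le> K + e"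
        using K [of t] elim by (fastforce simp: dist_real_def)
    qed (use assms(1) \<open>0 < e\<close> in simp)
  qed
  then show "norm (cont_fun_calc f T) \<le> K + e"
    by (intro tendsto_upperbound [OF tendsto_norm [OF cont_fun_calc_limit [OF T p]]]) auto
qed

lemma cont_fun_calc_intertwine:
  assumes T': "op_between m M T'" and "X o\<^sub>L T = T' o\<^sub>L X"
  shows "X o\<^sub>L cont_fun_calc f T = cont_fun_calc f T' o\<^sub>L X"
proof -
  obtain p where p: "uniform_limit {m..M} (\<lambda>n. poly (p n)) f sequentially"
    using polynomial_approximation [OF f] .
  have "(\<lambda>n. X o\<^sub>L op_poly (p n) T) \<longlonglongrightarrow> (X o\<^sub>L cont_fun_calc f T)"
    by (intro blinfun_compose.tendsto tendsto_const cont_fun_calc_limit [OF T p])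
  moreover have "(\<lambda>n. X o\<^sub>L op_poly (p n) T) \<longlonglongrightarrow> (cont_fun_calc f T' o\<^sub>L X)"
    unfolding op_poly_intertwine [OF assms(2)]
    by (intro blinfun_compose.tendsto tendsto_const cont_fun_calc_limit [OF T' p])
  ultimately show ?thesis by (rule LIMSEQ_unique)
qed

end

text \<open>A nonnegative function is the square of its square root, so \<open>f(T)\<close> is the square of a
  self-adjoint operator.\<close>

lemma cont_fun_calc_nonneg:
  assumes T: "op_between m M T" and f: "continuous_on {m..M} f"
    and nonneg: "\<And>t. t \<in> {m..M} \<Longrightarrow> 0 \<le> f t"
  shows "0 \<le> Re (cinner (blinfun_apply (cont_fun_calc f T) x) x)"
proof -
  define h where "h t = sqrt (f t)" for t
  have h: "continuous_on {m..M} h"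
    unfolding h_def by (intro continuous_intros f)
  note h_sa = self_adjoint_cont_fun_calc [OF T h]
  have "cont_fun_calc f T = cont_fun_calc (\<lambda>t. h t * h t) T"
    by (rule cont_fun_calc_cong [OF T f]) (simp add: h_def nonneg)
  also have "\<dots> = cont_fun_calc h T o\<^sub>L cont_fun_calc h T"
    by (rule cont_fun_calc_mult [OF T h h])
  finally have "Re (cinner (blinfun_apply (cont_fun_calc f T) x) x)
      = (norm (blinfun_apply (cont_fun_calc h T) x))\<^sup>2"
    by (simp add: norm_eq_Re_cinner self_adjointD(2) [OF h_sa])
  then show ?thesis by simp
qed

section \<open>Powers of positive invertible operators\<close>

lemma continuous_on_powr_Icc:
  fixes m M s :: real
  assumes "0 < m"
  shows "continuous_on {m..M} (\<lambda>t. t powr s)"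
  using assms by (intro continuous_intros) auto

text \<open>As \<open>t powr 0 = 1\<close> for \<open>t > 0\<close>, a positive lower bound lets one formula serve all
  exponents, \<open>s = 0\<close> included.\<close>

lemma op_powr_eq_cont_fun_calc:
  assumes P: "op_between m M P" and "0 < m"
  shows "op_powr P s = cont_fun_calc (\<lambda>t. t powr s) P"
  unfolding op_powr_def
  by (rule cont_fun_calc_cong [OF P continuous_on_powr_Icc [OF \<open>0 < m\<close>], symmetric])
    (use \<open>0 < m\<close> in auto)

lemma op_powr_add:
  assumes P: "op_between m M P" and "0 < m"
  shows "op_powr P (s + t) = op_powr P s o\<^sub>L op_powr P t"
  unfolding op_powr_eq_cont_fun_calc [OF assms] powr_add
  by (rule cont_fun_calc_mult [OF P]) (intro continuous_on_powr_Icc [OF \<open>0 < m\<close>])+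

lemma op_powr_1:
  assumes P: "op_between m M P" and "0 < m"
  shows "op_powr P 1 = P"
proof -
  have "op_powr P 1 = cont_fun_calc (\<lambda>t. t) P"
    unfolding op_powr_eq_cont_fun_calc [OF assms]
    by (rule cont_fun_calc_cong [OF P continuous_on_powr_Icc [OF \<open>0 < m\<close>]])
      (use \<open>0 < m\<close> in auto)
  then show ?thesis by (simp add: cont_fun_calc_id [OF P])
qed

lemma self_adjoint_op_powr:
  assumes "op_between m M P" "0 < m"
  shows "self_adjoint (op_powr P s)"
  unfolding op_powr_eq_cont_fun_calc [OF assms]
  by (rule self_adjoint_cont_fun_calc [OF assms(1) continuous_on_powr_Icc [OF assms(2)]])

lemma cinner_op_powr_double:
  assumes "op_between m M P" "0 < m"
  shows "cinner (blinfun_apply (op_powr P (2 * s)) x) x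
    = complex_of_real ((norm (blinfun_apply (op_powr P s) x))\<^sup>2)"
  using op_powr_add [OF assms, of s s]
  by (simp add: cinner_self self_adjointD(2) [OF self_adjoint_op_powr [OF assms]] flip: mult_2)

text \<open>The same polynomials have to approximate \<open>t\<^sup>s\<close> for both operators, hence the passage to an
  interval containing both ranges.\<close>

lemma op_powr_intertwine:
  assumes P: "op_between m M P" "0 < m" and Q: "op_between m' M' Q" "0 < m'"
    and "X o\<^sub>L P = Q o\<^sub>L X"
  shows "X o\<^sub>L op_powr P s = op_powr Q s o\<^sub>L X"
proof -
  let ?a = "min m m'" and ?b = "max M M'"
  have P': "op_between ?a ?b P" and Q': "op_between ?a ?b Q" and "0 < ?a"
    using P Q by (auto intro: op_between_mono)
  show ?thesis
    unfolding op_powr_eq_cont_fun_calc [OF P' \<open>0 < ?a\<close>] op_powr_eq_cont_fun_calc [OF Q' \<open>0 < ?a\<close>]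
    by (rule cont_fun_calc_intertwine [OF P' continuous_on_powr_Icc [OF \<open>0 < ?a\<close>] Q' assms(5)])
qed

lemma cont_fun_calc_scale:
  assumes T: "op_between m M T" and f: "continuous_on {m..M} f"
  shows "cont_fun_calc (\<lambda>t. c * f t) T = c *\<^sub>R cont_fun_calc f T"
  using cont_fun_calc_mult [OF T continuous_on_const f, of c]
  by (simp add: cont_fun_calc_const [OF T] blinfun_compose.scaleR_left)

text \<open>The map \<open>(s, t) \<mapsto> t\<^sup>s\<close> is uniformly continuous on \<open>[a, b] \<times> [m, M]\<close>, so \<open>t\<^sup>s\<close>
  depends continuously on \<open>s\<close> in the supremum norm over \<open>[m, M]\<close>, which controls the operator
  norm.\<close>

lemma continuous_on_op_powr:
  assumes P: "op_between m M P" and "0 < m"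
  shows "continuous_on {a..b} (op_powr P)"
  unfolding continuous_on_iff
proof (intro ballI allI impI)
  fix s e :: real assume s: "s \<in> {a..b}" and "0 < e"
  have "continuous_on ({a..b} \<times> {m..M}) (\<lambda>z. snd z powr fst z)"
    using \<open>0 < m\<close> by (intro continuous_intros) auto
  then have "uniformly_continuous_on ({a..b} \<times> {m..M}) (\<lambda>z. snd z powr fst z)"
    by (intro compact_uniformly_continuous compact_Times compact_Icc)
  then obtain d where "0 < d" and d: "\<And>z z'. z \<in> {a..b} \<times> {m..M} \<Longrightarrow> z' \<in> {a..b} \<times> {m..M}
      \<Longrightarrow> dist z' z < d \<Longrightarrow> dist (snd z' powr fst z') (snd z powr fst z) < e / 2"
    unfolding uniformly_continuous_on_def using \<open>0 < e\<close> half_gt_zero by metis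
  have "dist (op_powr P s') (op_powr P s) < e" if s': "s' \<in> {a..b}" "dist s' s < d" for s'
  proof -
    have c: "continuous_on {m..M} (\<lambda>t. t powr s')" "continuous_on {m..M} (\<lambda>t. (-1) * t powr s)"
      by (intro continuous_intros continuous_on_powr_Icc [OF \<open>0 < m\<close>])+
    have "op_powr P s' - op_powr P s = cont_fun_calc (\<lambda>t. t powr s' + (-1) * t powr s) P"
      unfolding cont_fun_calc_add [OF P c] cont_fun_calc_scale [OF P continuous_on_powr_Icc [OF \<open>0 < m\<close>]]
        op_powr_eq_cont_fun_calc [OF assms] by simp
    moreover have "norm \<dots> \<le> e / 2"
    proof (rule norm_cont_fun_calc_le [OF P])
      show "continuous_on {m..M} (\<lambda>t. t powr s' + (-1) * t powr s)"
        by (intro continuous_on_add c)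
      fix t assume "t \<in> {m..M}"
      then show "\<bar>t powr s' + (-1) * t powr s\<bar> \<le> e / 2"
        using d [of "(s, t)" "(s', t)"] s s' by (simp add: dist_Pair_Pair dist_real_def)
    qed (use \<open>0 < e\<close> in simp)
    ultimately show ?thesis using \<open>0 < e\<close> by (simp add: dist_norm)
  qed
  then show "\<exists>d>0. \<forall>s'\<in>{a..b}. dist s' s < d \<longrightarrow> dist (op_powr P s') (op_powr P s) < e"
    using \<open>0 < d\<close> by blast
qed

text \<open>The tangent line of \<open>u \<mapsto> u\<^sup>r\<close> at \<open>a\<close> lies below the graph. This is Young's inequality
  for \<open>u\<^sup>r\<close> and \<open>a\<^sup>r\<close> with weights \<open>1/r\<close> and \<open>1 - 1/r\<close>.\<close>

lemma powr_tangent: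
  fixes a u r :: real
  assumes "0 < a" "0 < u" "1 \<le> r"
  shows "r * a powr (r - 1) * u - (r - 1) * a powr r \<le> u powr r"
proof -
  have "(u powr r) powr (1 / r) * (a powr r) powr (1 - 1 / r)
      \<le> (1 / r) * u powr r + (1 - 1 / r) * a powr r"
    using assms by (intro Youngs_inequality_0) auto
  moreover have "r * (1 - 1 / r) = r - 1"
    using assms by (simp add: field_simps)
  ultimately have "u * a powr (r - 1) \<le> (1 / r) * u powr r + (1 - 1 / r) * a powr r"
    using assms by (simp add: powr_powr)
  then have "r * (u * a powr (r - 1)) \<le> r * ((1 / r) * u powr r + (1 - 1 / r) * a powr r)"
    using assms by (intro mult_left_mono) auto
  also have "\<dots> = u powr r + (r - 1) * a powr r"
    using assms by (simp add: field_simps)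
  finally show ?thesis by (simp add: algebra_simps)
qed

text \<open>McCarthy's inequality is Jensen's inequality for the spectral measure of \<open>x\<close>: apply
  functional calculus to the tangent line of \<open>u \<mapsto> u\<^sup>r\<close> at the mean value
  \<open>a = \<langle>P\<^sup>s x, x\<rangle>\<close>.\<close>

lemma McCarthy_inequality:
  assumes P: "op_between m M P" "0 < m" and "1 \<le> r" and x: "norm x = 1"
  shows "Re (cinner (blinfun_apply (op_powr P s) x) x) powr r
    \<le> Re (cinner (blinfun_apply (op_powr P (s * r)) x) x)"
proof -
  define a where "a = Re (cinner (blinfun_apply (op_powr P s) x) x)"
  have nonneg: "0 \<le> Re (cinner (blinfun_apply (op_powr P s') x) x)" for s'
    using cinner_op_powr_double [OF P, of "s' / 2" x] by simp
  show ?thesis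
  proof (cases "a = 0")
    case True
    then show ?thesis using nonneg by (simp add: a_def)
  next
    case False
    then have "0 < a" using nonneg [of s] by (simp add: a_def)
    define k where "k = - (r * a powr (r - 1))"
    define l where "l = (r - 1) * a powr r"
    note c = continuous_on_powr_Icc [OF P(2), where M = M]
    have c': "continuous_on {m..M} (\<lambda>t. k * t powr s)" "continuous_on {m..M} (\<lambda>t. k * t powr s + l)"
      by (intro continuous_intros c)+
    have pos: "0 \<le> t powr (s * r) + (k * t powr s + l)" if "t \<in> {m..M}" for t
      using powr_tangent [OF \<open>0 < a\<close>, of "t powr s" r] that P(2) \<open>1 \<le> r\<close>
      by (simp add: k_def l_def powr_powr)
    have "cont_fun_calc (\<lambda>t. t powr (s * r) + (k * t powr s + l)) P
        = op_powr P (s * r) + (k *\<^sub>R op_powr P s + l *\<^sub>R id_blinfun)"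
      unfolding cont_fun_calc_add [OF P(1) c c'(2)] cont_fun_calc_add [OF P(1) c'(1) continuous_on_const]
        cont_fun_calc_scale [OF P(1) c] cont_fun_calc_const [OF P(1)] op_powr_eq_cont_fun_calc [OF P] ..
    then have "0 \<le> Re (cinner (blinfun_apply
        (op_powr P (s * r) + (k *\<^sub>R op_powr P s + l *\<^sub>R id_blinfun)) x) x)"
      using cont_fun_calc_nonneg [OF P(1) continuous_on_add [OF c c'(2)] pos, of x] by metis
    also have "\<dots> = Re (cinner (blinfun_apply (op_powr P (s * r)) x) x) + (k * a + l)"
      by (simp add: blinfun.add_left blinfun.scaleR_left cinner_simps cinner_self x a_def)
    also have "k * a + l = - (a powr r)"
      using \<open>0 < a\<close> powr_mult_base [of a "r - 1"]
      by (simp add: k_def l_def algebra_simps)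
    finally show ?thesis by (simp add: a_def)
  qed
qed

section \<open>The modulus and the mixed Schwarz inequality\<close>

lemma op_between_norm:
  assumes "self_adjoint S" and "\<And>x. m * (norm x)\<^sup>2 \<le> Re (cinner (blinfun_apply S x) x)"
  shows "op_between m (norm S) S"
  unfolding op_between_def
proof (intro conjI allI assms)
  fix x
  have "Re (cinner (blinfun_apply S x) x) \<le> norm (blinfun_apply S x) * norm x"
    using cinner_Cauchy_Schwarz complex_Re_le_cmod order_trans by blast
  also have "\<dots> \<le> norm S * norm x * norm x"
    by (intro mult_right_mono norm_blinfun) simp
  finally show "Re (cinner (blinfun_apply S x) x) \<le> norm S * (norm x)\<^sup>2"
    by (simp add: power2_eq_square mult.assoc)
qed

lemma invertible_op_cadjoint:
  assumes A: "A \<in> bounded_ops" "invertible_op A"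
  shows "invertible_op (cadjoint A)"
proof -
  obtain S where S: "S \<in> bounded_ops" "S o\<^sub>L A = id_blinfun" "A o\<^sub>L S = id_blinfun"
    using A(2) by (auto simp: invertible_op_def)
  then have "blinfun_apply S (blinfun_apply A x) = x" "blinfun_apply A (blinfun_apply S x) = x" for x
    by (metis blinfun_apply_blinfun_compose blinfun_apply_id_blinfun id_apply)+
  then have "cadjoint S o\<^sub>L cadjoint A = id_blinfun" "cadjoint A o\<^sub>L cadjoint S = id_blinfun"
    by - (rule blinfun_eqI, rule cinner_eqI, simp add: cinner_cadjoint_right A(1) S(1))+
  then show ?thesis
    using cadjoint_in_bounded_ops [OF S(1)] by (auto simp: invertible_op_def)
qed

lemma cadjoint_compose_between:
  assumes A: "A \<in> bounded_ops" "invertible_op A"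
  shows "\<exists>m>0. \<exists>M. op_between m M (cadjoint A o\<^sub>L A)"
proof -
  obtain c where "c > 0" and c: "\<And>x. c * norm x \<le> norm (blinfun_apply A x)"
    using invertible_bounded_below [OF A(2)] by blast
  have "self_adjoint (cadjoint A o\<^sub>L A)"
    using A cadjoint_in_bounded_ops [OF A(1)]
    by (auto simp: self_adjoint_def cinner_cadjoint_left cinner_cadjoint_right)
  moreover have "c\<^sup>2 * (norm x)\<^sup>2 \<le> Re (cinner (blinfun_apply (cadjoint A o\<^sub>L A) x) x)" for x
    using power_mono [OF c [of x], of 2] \<open>c > 0\<close>
    by (simp add: cinner_cadjoint_left [OF A(1)] norm_eq_Re_cinner [of "blinfun_apply A x"]
        power_mult_distrib)
  ultimately have "op_between (c\<^sup>2) (norm (cadjoint A o\<^sub>L A)) (cadjoint A o\<^sub>L A)"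
    by (rule op_between_norm)
  then show ?thesis using \<open>c > 0\<close> by (meson zero_less_power)
qed

text \<open>If \<open>A\<^sup>*A \<ge> m > 0\<close>, then \<open>\<bar>A\<bar> \<ge> \<surd>m\<close> by positivity of the functional calculus. So
  \<open>\<bar>A\<bar>\<close> stays away from \<open>0\<close>, and \<open>t \<mapsto> t\<^sup>s\<close> is continuous where it is applied to
  \<open>\<bar>A\<bar>\<close>.\<close>

lemma op_abs_between:
  assumes A: "A \<in> bounded_ops" "invertible_op A"
  shows "\<exists>m>0. \<exists>M. op_between m M (op_abs A)"
proof -
  obtain m M where "0 < m" and T: "op_between m M (cadjoint A o\<^sub>L A)"
    using cadjoint_compose_between [OF A] by blast
  let ?f = "\<lambda>t::real. t powr (1/2)" and ?c = "m powr (1/2)"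
  have abs: "op_abs A = cont_fun_calc ?f (cadjoint A o\<^sub>L A)"
    unfolding op_abs_def by (rule op_powr_eq_cont_fun_calc [OF T \<open>0 < m\<close>])
  note c = continuous_on_powr_Icc [OF \<open>0 < m\<close>, of M "1/2"]
  have "cont_fun_calc (\<lambda>t. ?f t + (- ?c)) (cadjoint A o\<^sub>L A) = op_abs A + (- ?c) *\<^sub>R id_blinfun"
    unfolding cont_fun_calc_add [OF T c continuous_on_const] cont_fun_calc_const [OF T] abs ..
  moreover have "0 \<le> Re (cinner (blinfun_apply (cont_fun_calc (\<lambda>t. ?f t + (- ?c)) (cadjoint A o\<^sub>L A)) x) x)" for x
    using \<open>0 < m\<close> by (intro cont_fun_calc_nonneg [OF T] continuous_on_add c continuous_on_const)
      (simp add: powr_mono2)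
  ultimately have "?c * (norm x)\<^sup>2 \<le> Re (cinner (blinfun_apply (op_abs A) x) x)" for x
    by (simp add: blinfun.diff_left blinfun.scaleR_left cinner_simps cinner_self)
  then have "op_between ?c (norm (op_abs A)) (op_abs A)"
    using self_adjoint_cont_fun_calc [OF T c] by (intro op_between_norm) (simp_all add: abs)
  moreover have "0 < ?c" using \<open>0 < m\<close> by simp
  ultimately show ?thesis by blast
qed

lemma op_abs_squared:
  assumes A: "A \<in> bounded_ops" "invertible_op A"
  shows "op_abs A o\<^sub>L op_abs A = cadjoint A o\<^sub>L A"
proof -
  obtain m M where m: "0 < m" and T: "op_between m M (cadjoint A o\<^sub>L A)"
    using cadjoint_compose_between [OF A] by blast
  show ?thesis
    using op_powr_add [OF T m, of "1/2" "1/2"] by (simp add: op_abs_def op_powr_1 [OF T m])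
qed

text \<open>As \<open>A(A\<^sup>*A) = (AA\<^sup>*)A\<close>, the operator \<open>A\<close> intertwines all functions of \<open>A\<^sup>*A\<close> and
  \<open>AA\<^sup>*\<close>.\<close>

lemma op_abs_intertwine:
  assumes A: "A \<in> bounded_ops" "invertible_op A"
  shows "A o\<^sub>L op_abs A = op_abs (cadjoint A) o\<^sub>L A"
proof -
  obtain m M where T: "op_between m M (cadjoint A o\<^sub>L A)" "0 < m"
    using cadjoint_compose_between [OF A] by blast
  obtain m' M' where T': "op_between m' M' (A o\<^sub>L cadjoint A)" "0 < m'"
    using cadjoint_compose_between [OF cadjoint_in_bounded_ops [OF A(1)] invertible_op_cadjoint [OF A]]
    by (auto simp: cadjoint_cadjoint A)
  show ?thesis
    unfolding op_abs_def cadjoint_cadjoint [OF A(1)]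
    by (rule op_powr_intertwine [OF T T']) (simp add: blinfun_compose_assoc)
qed

text \<open>For \<open>V = A \<bar>A\<bar>\<^bsup>-1\<^esup>\<close> the identity \<open>\<bar>A\<bar>\<^sup>2 = A\<^sup>*A\<close> makes \<open>V\<close> isometric, and
  \<open>A\<bar>A\<bar> = \<bar>A\<^sup>*\<bar>A\<close> becomes \<open>V\<bar>A\<bar> = \<bar>A\<^sup>*\<bar>V\<close>.\<close>

lemma polar_decomposition:
  assumes A: "A \<in> bounded_ops" "invertible_op A"
  obtains V where "A = V o\<^sub>L op_abs A" "V o\<^sub>L op_abs A = op_abs (cadjoint A) o\<^sub>L V"
    "\<And>x. norm (blinfun_apply V x) = norm x"
proof -
  obtain m M where "0 < m" and C: "op_between m M (op_abs A)"
    using op_abs_between [OF A] by blast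
  note C_sa = self_adjointD [OF op_betweenD(1) [OF C]]
  have "invertible_op (op_abs A)"
    using coercive_invertible [OF C_sa(1) \<open>0 < m\<close> op_betweenD(2) [OF C]] .
  then obtain D where D: "D o\<^sub>L op_abs A = id_blinfun" "op_abs A o\<^sub>L D = id_blinfun"
    by (auto simp: invertible_op_def)
  have norm_eq: "norm (blinfun_apply A x) = norm (blinfun_apply (op_abs A) x)" for x
  proof -
    have "cinner (blinfun_apply A x) (blinfun_apply A x)
        = cinner (blinfun_apply (cadjoint A o\<^sub>L A) x) x"
      by (simp add: cinner_cadjoint_left [OF A(1)])
    also have "\<dots> = cinner (blinfun_apply (op_abs A) x) (blinfun_apply (op_abs A) x)"
      by (simp add: C_sa(2) flip: op_abs_squared [OF A])
    finally have "(norm (blinfun_apply A x))\<^sup>2 = (norm (blinfun_apply (op_abs A) x))\<^sup>2"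
      by (simp add: norm_eq_Re_cinner)
    then show ?thesis by (simp add: power2_eq_iff_nonneg)
  qed
  show ?thesis
  proof
    show AV: "A = (A o\<^sub>L D) o\<^sub>L op_abs A"
      by (simp add: blinfun_compose_assoc D)
    have "op_abs (cadjoint A) o\<^sub>L (A o\<^sub>L D) = (op_abs (cadjoint A) o\<^sub>L A) o\<^sub>L D"
      by (simp add: blinfun_compose_assoc)
    also have "\<dots> = A"
      by (simp add: blinfun_compose_assoc D flip: op_abs_intertwine [OF A])
    finally show "(A o\<^sub>L D) o\<^sub>L op_abs A = op_abs (cadjoint A) o\<^sub>L (A o\<^sub>L D)"
      using AV by simp
    show "norm (blinfun_apply (A o\<^sub>L D) x) = norm x" for x
    proof -
      have "norm (blinfun_apply (A o\<^sub>L D) x) = norm (blinfun_apply (op_abs A o\<^sub>L D) x)"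
        by (simp add: norm_eq)
      then show ?thesis by (simp add: D(2))
    qed
  qed
qed

text \<open>With the polar decomposition, \<open>A = V\<bar>A\<bar> = \<bar>A\<^sup>*\<bar>\<^bsup>1-\<theta>\<^esup> V \<bar>A\<bar>\<^sup>\<theta>\<close>, so
  \<open>\<langle>Ax, x\<rangle> = \<langle>V\<bar>A\<bar>\<^sup>\<theta>x, \<bar>A\<^sup>*\<bar>\<^bsup>1-\<theta>\<^esup>x\<rangle>\<close>, and \<open>\<parallel>\<bar>A\<bar>\<^sup>\<theta>x\<parallel>\<^sup>2 = \<langle>\<bar>A\<bar>\<^bsup>2\<theta>\<^esup>x, x\<rangle>\<close>.\<close>

lemma mixed_Schwarz_inequality:
  assumes A: "A \<in> bounded_ops" "invertible_op A"
  shows "(cmod (cinner (blinfun_apply A x) x))\<^sup>2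
    \<le> Re (cinner (blinfun_apply (op_powr (op_abs A) (2 * \<theta>)) x) x)
      * Re (cinner (blinfun_apply (op_powr (op_abs (cadjoint A)) (2 * (1 - \<theta>))) x) x)"
proof -
  let ?C = "op_abs A" and ?B = "op_abs (cadjoint A)"
  obtain m M where C: "op_between m M ?C" "0 < m"
    using op_abs_between [OF A] by blast
  obtain m' M' where B: "op_between m' M' ?B" "0 < m'"
    using op_abs_between [OF cadjoint_in_bounded_ops [OF A(1)] invertible_op_cadjoint [OF A]] by blast
  obtain V where V: "A = V o\<^sub>L ?C" "V o\<^sub>L ?C = ?B o\<^sub>L V"
    "\<And>x. norm (blinfun_apply V x) = norm x"
    using polar_decomposition [OF A] by blast
  have "?C = op_powr ?C (1 - \<theta>) o\<^sub>L op_powr ?C \<theta>"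
    using op_powr_add [OF C, of "1 - \<theta>" \<theta>] by (simp add: op_powr_1 [OF C])
  then have "A = (V o\<^sub>L op_powr ?C (1 - \<theta>)) o\<^sub>L op_powr ?C \<theta>"
    using V(1) by (simp add: blinfun_compose_assoc)
  also have "\<dots> = (op_powr ?B (1 - \<theta>) o\<^sub>L V) o\<^sub>L op_powr ?C \<theta>"
    by (simp add: op_powr_intertwine [OF C B V(2)])
  finally have "cinner (blinfun_apply A x) x
      = cinner (blinfun_apply V (blinfun_apply (op_powr ?C \<theta>) x)) (blinfun_apply (op_powr ?B (1 - \<theta>)) x)"
    by (metis blinfun_apply_blinfun_compose self_adjointD(2) [OF self_adjoint_op_powr [OF B]])
  then have "cmod (cinner (blinfun_apply A x) x)
      \<le> norm (blinfun_apply (op_powr ?C \<theta>) x) * norm (blinfun_apply (op_powr ?B (1 - \<theta>)) x)"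
    by (metis cinner_Cauchy_Schwarz V(3))
  then have "(cmod (cinner (blinfun_apply A x) x))\<^sup>2
      \<le> (norm (blinfun_apply (op_powr ?C \<theta>) x) * norm (blinfun_apply (op_powr ?B (1 - \<theta>)) x))\<^sup>2"
    by (intro power_mono) auto
  then show ?thesis
    unfolding cinner_op_powr_double [OF C] cinner_op_powr_double [OF B]
    by (simp add: power_mult_distrib)
qed

section \<open>The numerical radius\<close>

lemma numerical_radius_bdd:
  "bdd_above (insert 0 {cmod (cinner (blinfun_apply T x) x) | x. norm x = 1})"
proof (rule bdd_aboveI [of _ "norm T"])
  fix y assume "y \<in> insert 0 {cmod (cinner (blinfun_apply T x) x) | x. norm x = 1}"
  moreover have "cmod (cinner (blinfun_apply T x) x) \<le> norm T" if "norm x = 1" for x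
    using cinner_Cauchy_Schwarz [of "blinfun_apply T x" x] norm_blinfun [of T x] that by simp
  ultimately show "y \<le> norm T" by auto
qed

lemma cmod_cinner_le_numerical_radius:
  "norm x = 1 \<Longrightarrow> cmod (cinner (blinfun_apply T x) x) \<le> numerical_radius T"
  unfolding numerical_radius_def by (intro cSup_upper numerical_radius_bdd) auto

lemma numerical_radius_nonneg: "0 \<le> numerical_radius T"
  unfolding numerical_radius_def by (intro cSup_upper numerical_radius_bdd) auto

lemma numerical_radius_le:
  assumes "0 \<le> K" "\<And>x. norm x = 1 \<Longrightarrow> cmod (cinner (blinfun_apply T x) x) \<le> K"
  shows "numerical_radius T \<le> K"
  unfolding numerical_radius_def using assms by (intro cSup_least) auto

lemma numerical_radius_diff_le: "numerical_radius S \<le> numerical_radius T + norm (S - T)"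
proof (rule numerical_radius_le)
  fix x :: 'a assume x: "norm x = 1"
  have "cmod (cinner (blinfun_apply (S - T) x) x) \<le> norm (S - T)"
    using cinner_Cauchy_Schwarz [of "blinfun_apply (S - T) x" x] norm_blinfun [of "S - T" x] x by simp
  moreover have "cinner (blinfun_apply S x) x
      = cinner (blinfun_apply T x) x + cinner (blinfun_apply (S - T) x) x"
    by (simp add: blinfun.diff_left cinner_simps)
  ultimately show "cmod (cinner (blinfun_apply S x) x) \<le> numerical_radius T + norm (S - T)"
    by (metis add_mono cmod_cinner_le_numerical_radius norm_triangle_le x)
qed (simp add: numerical_radius_nonneg)

lemma continuous_on_numerical_radius: "continuous_on U numerical_radius"
  unfolding continuous_on_iff
proof (intro ballI allI impI)
  fix T :: "'a \<Rightarrow>\<^sub>L 'a" and e :: real assume "0 < e"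
  have "dist (numerical_radius S) (numerical_radius T) \<le> dist S T" for S
    using numerical_radius_diff_le [of S T] numerical_radius_diff_le [of T S]
    by (simp add: dist_norm abs_le_iff norm_minus_commute)
  then show "\<exists>d>0. \<forall>S\<in>U. dist S T < d \<longrightarrow> dist (numerical_radius S) (numerical_radius T) < e"
    using \<open>0 < e\<close> by (meson order_le_less_trans)
qed

text \<open>Mixed Schwarz and McCarthy bound the left-hand side by \<open>\<langle>Px, x\<rangle>\<langle>Qx, x\<rangle>\<close> with
  \<open>P = \<bar>A\<bar>\<^bsup>2r\<theta>\<^esup>\<close> and \<open>Q = \<bar>A\<^sup>*\<bar>\<^bsup>2r(1-\<theta>)\<^esup>\<close>. Buzano's inequality splits this product into
  \<open>(\<parallel>Px\<parallel>\<parallel>Qx\<parallel> + \<bar>\<langle>Px, Qx\<rangle>\<bar>)/2\<close>. In the numerator, the first summand is at most half of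
  \<open>\<langle>(P\<^sup>2 + Q\<^sup>2)x, x\<rangle>\<close>, the second is \<open>\<bar>\<langle>PQx, x\<rangle>\<bar>\<close>.\<close>

lemma cmod_cinner_powr_le_Phi:
  assumes A: "A \<in> bounded_ops" "invertible_op A" and "1 \<le> r" and x: "norm x = 1"
  shows "cmod (cinner (blinfun_apply A x) x) powr (2 * r) \<le> Phi A r \<theta>"
proof -
  let ?C = "op_abs A" and ?B = "op_abs (cadjoint A)"
  obtain m M where C: "op_between m M ?C" "0 < m"
    using op_abs_between [OF A] by blast
  obtain m' M' where B: "op_between m' M' ?B" "0 < m'"
    using op_abs_between [OF cadjoint_in_bounded_ops [OF A(1)] invertible_op_cadjoint [OF A]] by blast
  define P where "P = op_powr ?C (2 * r * \<theta>)"
  define Q where "Q = op_powr ?B (2 * r * (1 - \<theta>))"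
  have P_sa: "self_adjoint P" and Q_sa: "self_adjoint Q"
    unfolding P_def Q_def by (rule self_adjoint_op_powr, (rule C B)+)+
  have sq: "P o\<^sub>L P = op_powr ?C (4 * r * \<theta>)" "Q o\<^sub>L Q = op_powr ?B (4 * r * (1 - \<theta>))"
    unfolding P_def Q_def op_powr_add [OF C, symmetric] op_powr_add [OF B, symmetric]
    by (simp_all add: algebra_simps)
  define Px where "Px = blinfun_apply P x"
  define Qx where "Qx = blinfun_apply Q x"
  define a where "a = Re (cinner (blinfun_apply (op_powr ?C (2 * \<theta>)) x) x)"
  define b where "b = Re (cinner (blinfun_apply (op_powr ?B (2 * (1 - \<theta>))) x) x)"
  have ab: "0 \<le> a" "0 \<le> b"
    unfolding a_def b_def cinner_op_powr_double [OF C] cinner_op_powr_double [OF B] by simp_all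
  have "cmod (cinner (blinfun_apply A x) x) powr (2 * r)
      = ((cmod (cinner (blinfun_apply A x) x))\<^sup>2) powr r"
    by (simp add: powr_powr flip: powr_numeral)
  also have "\<dots> \<le> (a * b) powr r"
    using mixed_Schwarz_inequality [OF A, of x \<theta>] \<open>1 \<le> r\<close>
    by (intro powr_mono2) (auto simp: a_def b_def)
  also have "\<dots> = a powr r * b powr r"
    using ab by (simp add: powr_mult)
  also have "\<dots> \<le> Re (cinner Px x) * Re (cinner Qx x)"
    using McCarthy_inequality [OF C \<open>1 \<le> r\<close> x, of "2 * \<theta>"]
      McCarthy_inequality [OF B \<open>1 \<le> r\<close> x, of "2 * (1 - \<theta>)"]
    by (intro mult_mono) (auto simp: a_def b_def Px_def Qx_def P_def Q_def mult_ac intro: order_trans [OF powr_ge_zero])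
  also have "\<dots> \<le> cmod (cinner Px x) * cmod (cinner x Qx)"
  proof -
    have "\<bar>Re (cinner Px x)\<bar> * \<bar>Re (cinner Qx x)\<bar> \<le> cmod (cinner Px x) * cmod (cinner Qx x)"
      by (intro mult_mono abs_Re_le_cmod) auto
    moreover have "cmod (cinner x Qx) = cmod (cinner Qx x)"
      by (metis cinner_commute complex_mod_cnj)
    ultimately show ?thesis
      using abs_ge_self [of "Re (cinner Px x) * Re (cinner Qx x)"] by (simp add: abs_mult)
  qed
  also have "\<dots> \<le> (norm Px * norm Qx + cmod (cinner Px Qx)) / 2"
    using Buzano_inequality [OF x, of Px Qx] by (simp add: norm_mult)
  also have "\<dots> \<le> 1/4 * ((norm Px)\<^sup>2 + (norm Qx)\<^sup>2) + 1/2 * cmod (cinner Px Qx)"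
    using sum_squares_bound [of "norm Px" "norm Qx"] by simp
  also have "(norm Px)\<^sup>2 + (norm Qx)\<^sup>2 \<le> norm (op_powr ?C (4 * r * \<theta>) + op_powr ?B (4 * r * (1 - \<theta>)))"
  proof -
    have "(norm Px)\<^sup>2 + (norm Qx)\<^sup>2 = Re (cinner (blinfun_apply ((P o\<^sub>L P) + (Q o\<^sub>L Q)) x) x)"
      by (simp add: norm_eq_Re_cinner Px_def Qx_def blinfun.add_left cinner_simps
          self_adjointD(2) [OF P_sa] self_adjointD(2) [OF Q_sa])
    also have "\<dots> \<le> norm ((P o\<^sub>L P) + (Q o\<^sub>L Q)) * norm x * norm x"
      by (meson cinner_Cauchy_Schwarz complex_Re_le_cmod mult_right_mono norm_blinfun norm_ge_zero
          order_trans)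
    finally show ?thesis by (simp add: x sq)
  qed
  also have "cinner Px Qx = cnj (cinner (blinfun_apply (P o\<^sub>L Q) x) x)"
    by (simp add: Px_def Qx_def self_adjointD(2) [OF P_sa] flip: cinner_commute)
  also have "cmod \<dots> \<le> numerical_radius (P o\<^sub>L Q)"
    unfolding complex_mod_cnj by (rule cmod_cinner_le_numerical_radius [OF x])
  finally show ?thesis
    by (simp add: Phi_def P_def Q_def)
qed

lemma Phi_nonneg: "0 \<le> Phi A r \<theta>"
  by (simp add: Phi_def numerical_radius_nonneg)

lemma continuous_on_Phi:
  assumes A: "A \<in> bounded_ops" "invertible_op A" and "0 \<le> r"
  shows "continuous_on {0..1} (Phi A r)"
proof -
  let ?C = "op_abs A" and ?B = "op_abs (cadjoint A)"
  obtain m M where C: "op_between m M ?C" "0 < m"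
    using op_abs_between [OF A] by blast
  obtain m' M' where B: "op_between m' M' ?B" "0 < m'"
    using op_abs_between [OF cadjoint_in_bounded_ops [OF A(1)] invertible_op_cadjoint [OF A]] by blast
  have *: "continuous_on {0..1} (\<lambda>\<theta>. op_powr ?C (k * r * \<theta>))"
    "continuous_on {0..1} (\<lambda>\<theta>. op_powr ?B (k * r * (1 - \<theta>)))" if "0 \<le> k" for k
    using that \<open>0 \<le> r\<close>
    by (auto intro!: continuous_intros mult_left_le
        continuous_on_compose2 [OF continuous_on_op_powr [OF C, of 0 "k * r"]]
        continuous_on_compose2 [OF continuous_on_op_powr [OF B, of 0 "k * r"]])
  show ?thesis
    unfolding Phi_def
    by (intro continuous_intros * blinfun_compose.continuous_on
        continuous_on_compose2 [OF continuous_on_numerical_radius [of UNIV]]) auto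
qed

theorem proposition2p5:
  fixes A :: "'a::complex_hilbert_space \<Rightarrow>\<^sub>L 'a" and r :: real
  assumes "A \<in> bounded_ops" and "invertible_op A" and "r \<ge> 1"
  shows "(\<exists>m. m \<in> Phi A r ` {0..1} \<and> (\<forall>\<theta>\<in>{0..1}. m \<le> Phi A r \<theta>)
            \<and> numerical_radius A powr (2 * r) \<le> m
            \<and> m \<le> Phi A r (1/2)
            \<and> (\<forall>\<theta>\<^sub>0\<in>{0..1}. Phi A r \<theta>\<^sub>0 < Phi A r (1/2) \<longrightarrow> m < Phi A r (1/2)))
       \<and> Phi A r (1/2) =
            1/4 * norm (op_powr (op_abs A) (2 * r) + op_powr (op_abs (cadjoint A)) (2 * r))
            + 1/2 * numerical_radius (op_powr (op_abs A) r o\<^sub>L op_powr (op_abs (cadjoint A)) r)"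
proof (rule conjI)
  obtain \<theta> where \<theta>: "\<theta> \<in> {0..1}" and min: "\<And>\<theta>'. \<theta>' \<in> {0..1} \<Longrightarrow> Phi A r \<theta> \<le> Phi A r \<theta>'"
    using continuous_attains_inf [OF compact_Icc _ continuous_on_Phi [OF assms(1,2), of r]] \<open>r \<ge> 1\<close>
    by force
  have "numerical_radius A \<le> Phi A r \<theta> powr (1 / (2 * r))"
  proof (rule numerical_radius_le)
    fix x :: 'a assume "norm x = 1"
    from cmod_cinner_powr_le_Phi [OF assms this, of \<theta>]
    have "(cmod (cinner (blinfun_apply A x) x) powr (2 * r)) powr (1 / (2 * r))
        \<le> Phi A r \<theta> powr (1 / (2 * r))"
      using \<open>r \<ge> 1\<close> by (intro powr_mono2) auto
    then show "cmod (cinner (blinfun_apply A x) x) \<le> Phi A r \<theta> powr (1 / (2 * r))"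
      using \<open>r \<ge> 1\<close> by (simp add: powr_powr)
  qed simp
  then have "numerical_radius A powr (2 * r) \<le> (Phi A r \<theta> powr (1 / (2 * r))) powr (2 * r)"
    using \<open>r \<ge> 1\<close> by (intro powr_mono2) (auto simp: numerical_radius_nonneg)
  also have "\<dots> = Phi A r \<theta>"
    using \<open>r \<ge> 1\<close> by (simp add: powr_powr Phi_nonneg)
  finally have "numerical_radius A powr (2 * r) \<le> Phi A r \<theta>" .
  moreover have "Phi A r \<theta> < Phi A r (1/2)"
    if "\<theta>\<^sub>0 \<in> {0..1}" "Phi A r \<theta>\<^sub>0 < Phi A r (1/2)" for \<theta>\<^sub>0
    using min [OF that(1)] that(2) by linarith
  ultimately show "\<exists>m. m \<in> Phi A r ` {0..1} \<and> (\<forall>\<theta>\<in>{0..1}. m \<le> Phi A r \<theta>)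
            \<and> numerical_radius A powr (2 * r) \<le> m
            \<and> m \<le> Phi A r (1/2)
            \<and> (\<forall>\<theta>\<^sub>0\<in>{0..1}. Phi A r \<theta>\<^sub>0 < Phi A r (1/2) \<longrightarrow> m < Phi A r (1/2))"
    using \<theta> min by (intro exI [of _ "Phi A r \<theta>"]) auto
qed (simp add: Phi_def)

end
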